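(* Let $G$ be a group, $k$ a unital commutative ring, and let $\alpha^{(1)}=(D^{(1)}_g,\alpha^{(1)}_g)_{g\in G}$ and $\alpha^{(2)}=(D^{(2)}_g,\alpha^{(2)}_g)_{g\in G}$ be regular partial actions of $G$ on the unital $k$-algebras $R_1$ and $R_2$, respectively. Assume that $\alpha^{(1)}$ and $\alpha^{(2)}$ are Morita equivalent and that $(R_1,R_2,M_{12},M_{21},\tau_{12},\tau_{21})$ is a Morita context that satisfies condition (i) of the definition of Morita equivalence (that is, $\tau_{12},\tau_{21}$ are surjective, $M_{12},M_{21}$ are unital bimodules and $M_{21}D^{(1)}_gM_{12}=D^{(2)}_g$ for all $g\in G$), and such that, with $M_{11}=R_1$, $M_{22}=R_2$, $$D^{(i)}_gM_{ij}\cap D^{(i)}_hM_{ij}=\big(D^{(i)}_g\cap D^{(i)}_h\big)M_{ij},\qquad i,j\in\{1,2\},\ g,h\in G.$$ Then there is a datum $\mathcal{D}=\big(\{\alpha^{(i)}\}_{i\in\{1,2\}},\{\gamma_g\}_{g\in G}\big)$ for the Morita ring $R=\begin{pmatrix} R_1 & M_{12} \\ M_{21} & R_2 \end{pmatrix}$.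
   Context: Rings are associative; modules over unital rings are unital. A Morita context $(A,A',M,M',\tau,\tau')$ consists of rings $A,A'$, an $(A,A')$-bimodule $M$, an $(A',A)$-bimodule $M'$ and bimodule maps $\tau:M\otimes_{A'}M'\to A$, $\tau':M'\otimes_AM\to A'$ (written as products) satisfying the usual associativity; the Morita ring $\begin{pmatrix} A & M \\ M' & A' \end{pmatrix}$ has componentwise addition and row-column multiplication. Products such as $DM$ denote the additive subgroup generated by all products. A partial action of a group $G$ (identity $e$) on a ring $A$ is a family $\alpha=(A_g,\alpha_g)_{g\in G}$ where each $A_g$ is an ideal of $A$ and $\alpha_g:A_{g^{-1}}\to A_g$ is a ring isomorphism, such that (i) $A_e=A$, $\alpha_e=\mathrm{id}_A$; (ii) $\alpha_{h^{-1}}(A_h\cap A_{g^{-1}})\subset A_{(gh)^{-1}}$ for all $g,h\in G$; (iii) $\alpha_g(\alpha_h(a))=\alpha_{gh}(a)$ for all $a\in\alpha_h^{-1}(A_h\cap A_{g^{-1}})$. For a partial action on a $k$-algebra the $\alpha_g$ are $k$-algebra isomorphisms. It is regular if $A_{g_1}\cap\dots\cap A_{g_m}=A_{g_1}\cdots A_{g_m}$ for all $m>0$ and $g_1,\dots,g_m\in G$. A product partial action of $G$ on $A$ is a family $(A_g,\alpha_g)_{g\in G}$ of ideals $A_g$ and ring isomorphisms $\alpha_g:A_{g^{-1}}\to A_g$ with $A_e=A$, $\alpha_e=\mathrm{id}_A$; $A_g^2=A_g$, $A_gA_h=A_hA_g$; $\alpha_g(A_{g^{-1}}A_h)=A_gA_{gh}$;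 and $\alpha_g(\alpha_h(a))=\alpha_{gh}(a)$ for all $a\in A_{h^{-1}}A_{(gh)^{-1}}$ ($g,h\in G$). Morita equivalence: regular partial actions $\alpha=(D_g,\alpha_g)_{g\in G}$ and $\alpha'=(D'_g,\alpha'_g)_{g\in G}$ of $G$ on $k$-algebras $A$ and $A'$ are Morita equivalent if (i) there is a Morita context $(A,A',M,M',\tau,\tau')$ with $\tau,\tau'$ surjective, $M,M'$ unital bimodules, and $M'D_gM=D'_g$ for all $g\in G$; and (ii) there is a product partial action $\theta$ of $G$ on the Morita ring $\begin{pmatrix} A & M \\ M' & A' \end{pmatrix}$ whose restriction to $\begin{pmatrix} A & 0 \\ 0 & 0 \end{pmatrix}$ is $\alpha$ and whose restriction to $\begin{pmatrix} 0 & 0 \\ 0 & A' \end{pmatrix}$ is $\alpha'$. Datum for $R=(M_{ij})_{i,j\in\{1,2\}}$: a pair $\mathcal{D}=\big(\{\alpha^{(i)}\}_{i},\{\gamma_g\}_{g\in G}\big)$, where $\alpha^{(i)}=(D^{(i)}_g,\alpha^{(i)}_g)_{g\in G}$ is a partial action of $G$ on $R_i$ and $\gamma_g=\{\gamma^{(ij)}_g:D^{(i)}_{g^{-1}}M_{ij}\to D^{(i)}_gM_{ij}\}_{i,j}$ is a set of additive bijections, such that: (a) $D^{(i)}_gM_{ij}=M_{ij}D^{(j)}_g$ for all $g\in G$ and all $i,j$; (b) for all $g,h\in G$ and all $i,j,k\in\{1,2\}$: $\gamma^{(ii)}_g=\alpha^{(i)}_g$ and $\gamma^{(ij)}_e=\mathrm{id}_{M_{ij}}$;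 $\gamma^{(ik)}_g(u)\gamma^{(kj)}_g(v)=\gamma^{(ij)}_g(uv)$ for all $u\in D^{(i)}_{g^{-1}}M_{ik}$, $v\in D^{(k)}_{g^{-1}}M_{kj}$; $(\gamma^{(ij)}_h)^{-1}\big(D^{(i)}_{g^{-1}}M_{ij}\cap D^{(i)}_hM_{ij}\big)\subset D^{(i)}_{(gh)^{-1}}M_{ij}$; and $\gamma^{(ij)}_g(\gamma^{(ij)}_h(a))=\gamma^{(ij)}_{gh}(a)$ for all $a\in(\gamma^{(ij)}_h)^{-1}\big(D^{(i)}_{g^{-1}}M_{ij}\cap D^{(i)}_hM_{ij}\big)$.
   Formalization: The given Morita context is required to satisfy condition (ii) as well as (i), that is, its own Morita ring carries the product partial action restricting to both actions; for a context satisfying only (i) the claim is false. *)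

theory Defs
  imports "HOL-Algebra.Generated_Groups" "HOL-Algebra.Ideal" "HOL-Algebra.Module"
begin

section \<open>Products of additive subgroups, k-algebras, bimodules\<close>

text \<open>
  The product of two sets of elements under a biadditive operation \<open>f\<close> with values in
  the additive group of \<open>Z\<close> is the additive subgroup generated by all values of \<open>f\<close>.  The
  operation is a parameter because it is a ring multiplication, a scalar multiplication of a
  bimodule, or a Morita pairing, depending on the factors.
\<close>

definition set_product ::
    "('c, 'z) ring_scheme \<Rightarrow> ('a \<Rightarrow> 'b \<Rightarrow> 'c) \<Rightarrow> 'a set \<Rightarrow> 'b set \<Rightarrow> 'c set" where
  "set_product Z f S T = generate (add_monoid Z) {f s t | s t. s \<in> S \<and> t \<in> T}"

text \<open>The locale \<open>algebra\<close> of the library is restricted to commutative algebras.\<close>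

locale unital_algebra = module K A + ring A for K (structure) and A (structure) +
  assumes smult_mult_left: "\<lbrakk>c \<in> carrier K; x \<in> carrier A; y \<in> carrier A\<rbrakk> \<Longrightarrow>
      (c \<odot>\<^bsub>A\<^esub> x) \<otimes>\<^bsub>A\<^esub> y = c \<odot>\<^bsub>A\<^esub> (x \<otimes>\<^bsub>A\<^esub> y)"
    and smult_mult_right: "\<lbrakk>c \<in> carrier K; x \<in> carrier A; y \<in> carrier A\<rbrakk> \<Longrightarrow>
      x \<otimes>\<^bsub>A\<^esub> (c \<odot>\<^bsub>A\<^esub> y) = c \<odot>\<^bsub>A\<^esub> (x \<otimes>\<^bsub>A\<^esub> y)"

text \<open>
  As for the library's \<open>module\<close> record, only the additive part of the underlying ring record is
  meaningful.
\<close>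

record ('a, 'b, 'm) bimodule = "'m ring" +
  lsmult :: "'a \<Rightarrow> 'm \<Rightarrow> 'm"
  rsmult :: "'m \<Rightarrow> 'b \<Rightarrow> 'm"

locale bimodule = A: ring A + B: ring B + M: abelian_group M
  for A (structure) and B (structure) and M (structure) +
  assumes lsmult_closed: "\<lbrakk>a \<in> carrier A; x \<in> carrier M\<rbrakk> \<Longrightarrow> lsmult M a x \<in> carrier M"
    and rsmult_closed: "\<lbrakk>x \<in> carrier M; b \<in> carrier B\<rbrakk> \<Longrightarrow> rsmult M x b \<in> carrier M"
    and lsmult_add_left: "\<lbrakk>a \<in> carrier A; a' \<in> carrier A; x \<in> carrier M\<rbrakk> \<Longrightarrow>
      lsmult M (a \<oplus>\<^bsub>A\<^esub> a') x = lsmult M a x \<oplus>\<^bsub>M\<^esub> lsmult M a' x"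
    and lsmult_add_right: "\<lbrakk>a \<in> carrier A; x \<in> carrier M; y \<in> carrier M\<rbrakk> \<Longrightarrow>
      lsmult M a (x \<oplus>\<^bsub>M\<^esub> y) = lsmult M a x \<oplus>\<^bsub>M\<^esub> lsmult M a y"
    and rsmult_add_left: "\<lbrakk>x \<in> carrier M; y \<in> carrier M; b \<in> carrier B\<rbrakk> \<Longrightarrow>
      rsmult M (x \<oplus>\<^bsub>M\<^esub> y) b = rsmult M x b \<oplus>\<^bsub>M\<^esub> rsmult M y b"
    and rsmult_add_right: "\<lbrakk>x \<in> carrier M; b \<in> carrier B; b' \<in> carrier B\<rbrakk> \<Longrightarrow>
      rsmult M x (b \<oplus>\<^bsub>B\<^esub> b') = rsmult M x b \<oplus>\<^bsub>M\<^esub> rsmult M x b'"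
    and lsmult_assoc: "\<lbrakk>a \<in> carrier A; a' \<in> carrier A; x \<in> carrier M\<rbrakk> \<Longrightarrow>
      lsmult M (a \<otimes>\<^bsub>A\<^esub> a') x = lsmult M a (lsmult M a' x)"
    and rsmult_assoc: "\<lbrakk>x \<in> carrier M; b \<in> carrier B; b' \<in> carrier B\<rbrakk> \<Longrightarrow>
      rsmult M x (b \<otimes>\<^bsub>B\<^esub> b') = rsmult M (rsmult M x b) b'"
    and lsmult_rsmult: "\<lbrakk>a \<in> carrier A; x \<in> carrier M; b \<in> carrier B\<rbrakk> \<Longrightarrow>
      rsmult M (lsmult M a x) b = lsmult M a (rsmult M x b)"
    and lsmult_one: "x \<in> carrier M \<Longrightarrow> lsmult M \<one>\<^bsub>A\<^esub> x = x"
    and rsmult_one: "x \<in> carrier M \<Longrightarrow> rsmult M x \<one>\<^bsub>B\<^esub> = x"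


section \<open>Morita contexts and Morita rings\<close>

text \<open>
  A bimodule homomorphism \<open>L \<otimes> N \<rightarrow> A\<close> on a tensor product over \<open>B\<close>, given as the corresponding
  \<open>B\<close>-balanced biadditive map \<open>t\<close>.
\<close>

definition bimodule_pairing ::
    "('a, 'x) ring_scheme \<Rightarrow> ('b, 'y) ring_scheme \<Rightarrow> ('a, 'b, 'm, 'u) bimodule_scheme \<Rightarrow>
     ('b, 'a, 'n, 'v) bimodule_scheme \<Rightarrow> ('m \<Rightarrow> 'n \<Rightarrow> 'a) \<Rightarrow> bool" where
  "bimodule_pairing A B L N t \<longleftrightarrow>
    (\<forall>x\<in>carrier L. \<forall>y\<in>carrier N. t x y \<in> carrier A) \<and>
    (\<forall>x\<in>carrier L. \<forall>x'\<in>carrier L. \<forall>y\<in>carrier N. t (x \<oplus>\<^bsub>L\<^esub> x') y = t x y \<oplus>\<^bsub>A\<^esub> t x' y) \<and>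
    (\<forall>x\<in>carrier L. \<forall>y\<in>carrier N. \<forall>y'\<in>carrier N. t x (y \<oplus>\<^bsub>N\<^esub> y') = t x y \<oplus>\<^bsub>A\<^esub> t x y') \<and>
    (\<forall>x\<in>carrier L. \<forall>b\<in>carrier B. \<forall>y\<in>carrier N. t (rsmult L x b) y = t x (lsmult N b y)) \<and>
    (\<forall>a\<in>carrier A. \<forall>x\<in>carrier L. \<forall>y\<in>carrier N. t (lsmult L a x) y = a \<otimes>\<^bsub>A\<^esub> t x y) \<and>
    (\<forall>x\<in>carrier L. \<forall>y\<in>carrier N. \<forall>a\<in>carrier A. t x (rsmult N y a) = t x y \<otimes>\<^bsub>A\<^esub> a)"

locale morita_context = M: bimodule A A' M + M': bimodule A' A M'
  for A (structure) and A' (structure) and M (structure) and M' (structure) +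
  fixes \<tau> :: "'m \<Rightarrow> 'n \<Rightarrow> 'a" and \<tau>' :: "'n \<Rightarrow> 'm \<Rightarrow> 'b"
  assumes tau_pairing: "bimodule_pairing A A' M M' \<tau>"
    and tau'_pairing: "bimodule_pairing A' A M' M \<tau>'"
    and tau_assoc: "\<lbrakk>x \<in> carrier M; y \<in> carrier M'; x' \<in> carrier M\<rbrakk> \<Longrightarrow>
      lsmult M (\<tau> x y) x' = rsmult M x (\<tau>' y x')"
    and tau'_assoc: "\<lbrakk>y \<in> carrier M'; x \<in> carrier M; y' \<in> carrier M'\<rbrakk> \<Longrightarrow>
      lsmult M' (\<tau>' y x) y' = rsmult M' y (\<tau> x y')"

text \<open>The tuple \<open>(a, x, y, b)\<close> is the matrix with rows \<open>(a, x)\<close> and \<open>(y, b)\<close>.\<close>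

definition morita_ring ::
    "('a, 'x) ring_scheme \<Rightarrow> ('b, 'y) ring_scheme \<Rightarrow> ('a, 'b, 'm, 'u) bimodule_scheme \<Rightarrow>
     ('b, 'a, 'n, 'v) bimodule_scheme \<Rightarrow> ('m \<Rightarrow> 'n \<Rightarrow> 'a) \<Rightarrow> ('n \<Rightarrow> 'm \<Rightarrow> 'b) \<Rightarrow>
     ('a \<times> 'm \<times> 'n \<times> 'b) ring" where
  "morita_ring A A' M M' \<tau> \<tau>' =
    \<lparr>carrier = carrier A \<times> carrier M \<times> carrier M' \<times> carrier A',
     monoid.mult = (\<lambda>(a, x, y, b) (a', x', y', b').
       (a \<otimes>\<^bsub>A\<^esub> a' \<oplus>\<^bsub>A\<^esub> \<tau> x y',
        lsmult M a x' \<oplus>\<^bsub>M\<^esub> rsmult M x b',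
        rsmult M' y a' \<oplus>\<^bsub>M'\<^esub> lsmult M' b y',
        \<tau>' y x' \<oplus>\<^bsub>A'\<^esub> b \<otimes>\<^bsub>A'\<^esub> b')),
     one = (\<one>\<^bsub>A\<^esub>, \<zero>\<^bsub>M\<^esub>, \<zero>\<^bsub>M'\<^esub>, \<one>\<^bsub>A'\<^esub>),
     zero = (\<zero>\<^bsub>A\<^esub>, \<zero>\<^bsub>M\<^esub>, \<zero>\<^bsub>M'\<^esub>, \<zero>\<^bsub>A'\<^esub>),
     add = (\<lambda>(a, x, y, b) (a', x', y', b').
       (a \<oplus>\<^bsub>A\<^esub> a', x \<oplus>\<^bsub>M\<^esub> x', y \<oplus>\<^bsub>M'\<^esub> y', b \<oplus>\<^bsub>A'\<^esub> b'))\<rparr>"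


section \<open>Partial actions\<close>

text \<open>
  Ideals are regarded as rings without unit, so the library's \<open>ring_iso\<close> (which preserves the
  unit) does not apply.
\<close>

definition ideal_iso :: "('a, 'x) ring_scheme \<Rightarrow> 'a set \<Rightarrow> 'a set \<Rightarrow> ('a \<Rightarrow> 'a) \<Rightarrow> bool" where
  "ideal_iso A I J f \<longleftrightarrow> bij_betw f I J \<and>
    (\<forall>x\<in>I. \<forall>y\<in>I. f (x \<oplus>\<^bsub>A\<^esub> y) = f x \<oplus>\<^bsub>A\<^esub> f y \<and> f (x \<otimes>\<^bsub>A\<^esub> y) = f x \<otimes>\<^bsub>A\<^esub> f y)"

text \<open>
  Here \<open>\<alpha> g\<close> is only meaningful on \<open>D (inv g)\<close>, and the inverse image of a set \<open>S\<close> under the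
  bijection \<open>\<alpha> h\<close> is \<open>{a \<in> D (inv h). \<alpha> h a \<in> S}\<close>.  Condition (ii) is stated with the map
  \<open>\<alpha> (inv h)\<close>, condition (iii) with the inverse of \<open>\<alpha> h\<close>.
\<close>

locale partial_action = G: group G + A: ring A for G (structure) and A (structure) +
  fixes D :: "'g \<Rightarrow> 'a set" and \<alpha> :: "'g \<Rightarrow> 'a \<Rightarrow> 'a"
  assumes dom_ideal: "g \<in> carrier G \<Longrightarrow> ideal (D g) A"
    and act_iso: "g \<in> carrier G \<Longrightarrow> ideal_iso A (D (inv\<^bsub>G\<^esub> g)) (D g) (\<alpha> g)"
    and dom_one: "D \<one>\<^bsub>G\<^esub> = carrier A"
    and act_one: "a \<in> carrier A \<Longrightarrow> \<alpha> \<one>\<^bsub>G\<^esub> a = a"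
    and act_dom: "\<lbrakk>g \<in> carrier G; h \<in> carrier G\<rbrakk> \<Longrightarrow>
      \<alpha> (inv\<^bsub>G\<^esub> h) ` (D h \<inter> D (inv\<^bsub>G\<^esub> g)) \<subseteq> D (inv\<^bsub>G\<^esub> (g \<otimes>\<^bsub>G\<^esub> h))"
    and act_comp: "\<lbrakk>g \<in> carrier G; h \<in> carrier G;
        a \<in> D (inv\<^bsub>G\<^esub> h); \<alpha> h a \<in> D h \<inter> D (inv\<^bsub>G\<^esub> g)\<rbrakk> \<Longrightarrow>
      \<alpha> g (\<alpha> h a) = \<alpha> (g \<otimes>\<^bsub>G\<^esub> h) a"

locale algebra_partial_action = partial_action G A D \<alpha> + unital_algebra K A
  for K (structure) and G (structure) and A (structure)
    and D :: "'g \<Rightarrow> 'a set" and \<alpha> :: "'g \<Rightarrow> 'a \<Rightarrow> 'a" +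
  assumes act_smult: "\<lbrakk>g \<in> carrier G; c \<in> carrier K; a \<in> D (inv\<^bsub>G\<^esub> g)\<rbrakk> \<Longrightarrow>
      \<alpha> g (c \<odot>\<^bsub>A\<^esub> a) = c \<odot>\<^bsub>A\<^esub> \<alpha> g a"

text \<open>
  For \<open>gs = [g\<^sub>1, \<dots>, g\<^sub>m]\<close>, the right-hand side below is the additive subgroup generated by all
  products \<open>x\<^sub>1 \<cdots> x\<^sub>m\<close> with \<open>x\<^sub>i \<in> D g\<^sub>i\<close>.
\<close>

definition regular_domains ::
    "('g, 'w) monoid_scheme \<Rightarrow> ('a, 'x) ring_scheme \<Rightarrow> ('g \<Rightarrow> 'a set) \<Rightarrow> bool" where
  "regular_domains G A D \<longleftrightarrow>
    (\<forall>gs. gs \<noteq> [] \<longrightarrow> set gs \<subseteq> carrier G \<longrightarrow>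
      (\<Inter>g\<in>set gs. D g) =
      generate (add_monoid A)
        {foldr (\<otimes>\<^bsub>A\<^esub>) xs \<one>\<^bsub>A\<^esub> | xs. list_all2 (\<lambda>x g. x \<in> D g) xs gs})"

locale product_partial_action = G: group G + A: ring A for G (structure) and A (structure) +
  fixes D :: "'g \<Rightarrow> 'a set" and \<theta> :: "'g \<Rightarrow> 'a \<Rightarrow> 'a"
  assumes dom_ideal: "g \<in> carrier G \<Longrightarrow> ideal (D g) A"
    and act_iso: "g \<in> carrier G \<Longrightarrow> ideal_iso A (D (inv\<^bsub>G\<^esub> g)) (D g) (\<theta> g)"
    and dom_one: "D \<one>\<^bsub>G\<^esub> = carrier A"
    and act_one: "a \<in> carrier A \<Longrightarrow> \<theta> \<one>\<^bsub>G\<^esub> a = a"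
    and dom_idem: "g \<in> carrier G \<Longrightarrow> set_product A (\<otimes>\<^bsub>A\<^esub>) (D g) (D g) = D g"
    and dom_comm: "\<lbrakk>g \<in> carrier G; h \<in> carrier G\<rbrakk> \<Longrightarrow>
      set_product A (\<otimes>\<^bsub>A\<^esub>) (D g) (D h) = set_product A (\<otimes>\<^bsub>A\<^esub>) (D h) (D g)"
    and act_dom: "\<lbrakk>g \<in> carrier G; h \<in> carrier G\<rbrakk> \<Longrightarrow>
      \<theta> g ` set_product A (\<otimes>\<^bsub>A\<^esub>) (D (inv\<^bsub>G\<^esub> g)) (D h) =
      set_product A (\<otimes>\<^bsub>A\<^esub>) (D g) (D (g \<otimes>\<^bsub>G\<^esub> h))"
    and act_comp: "\<lbrakk>g \<in> carrier G; h \<in> carrier G;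
        a \<in> set_product A (\<otimes>\<^bsub>A\<^esub>) (D (inv\<^bsub>G\<^esub> h)) (D (inv\<^bsub>G\<^esub> (g \<otimes>\<^bsub>G\<^esub> h)))\<rbrakk> \<Longrightarrow>
      \<theta> g (\<theta> h a) = \<theta> (g \<otimes>\<^bsub>G\<^esub> h) a"


section \<open>Morita equivalence of partial actions\<close>

text \<open>
  Surjectivity of a map on a tensor product means that the values of the corresponding pairing
  generate the codomain additively.  That \<open>M\<close> and \<open>M'\<close> are unital is part of \<open>bimodule\<close>.
\<close>

definition morita_equivalence_i ::
    "('g, 'w) monoid_scheme \<Rightarrow> ('a, 'x) ring_scheme \<Rightarrow> ('b, 'y) ring_scheme \<Rightarrow>
     ('a, 'b, 'm, 'u) bimodule_scheme \<Rightarrow> ('b, 'a, 'n, 'v) bimodule_scheme \<Rightarrow>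
     ('m \<Rightarrow> 'n \<Rightarrow> 'a) \<Rightarrow> ('n \<Rightarrow> 'm \<Rightarrow> 'b) \<Rightarrow> ('g \<Rightarrow> 'a set) \<Rightarrow> ('g \<Rightarrow> 'b set) \<Rightarrow> bool" where
  "morita_equivalence_i G A A' M M' \<tau> \<tau>' D D' \<longleftrightarrow>
    morita_context A A' M M' \<tau> \<tau>' \<and>
    set_product A \<tau> (carrier M) (carrier M') = carrier A \<and>
    set_product A' \<tau>' (carrier M') (carrier M) = carrier A' \<and>
    (\<forall>g\<in>carrier G.
      set_product A' \<tau>' (set_product M' (rsmult M') (carrier M') (D g)) (carrier M) = D' g)"

text \<open>
  The restriction of the family \<open>\<theta> g : C (inv g) \<rightarrow> C g\<close> to the image of an embedding \<open>\<iota>\<close> of \<open>A\<close>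
  is \<open>\<alpha>\<close>: the ideal \<open>C g\<close> meets the image in the image of \<open>D g\<close>, and there \<open>\<theta> g\<close> acts as \<open>\<alpha> g\<close>.
\<close>

definition restricts_to ::
    "('g, 'w) monoid_scheme \<Rightarrow> ('a, 'x) ring_scheme \<Rightarrow> ('a \<Rightarrow> 'r) \<Rightarrow> ('g \<Rightarrow> 'r set) \<Rightarrow>
     ('g \<Rightarrow> 'r \<Rightarrow> 'r) \<Rightarrow> ('g \<Rightarrow> 'a set) \<Rightarrow> ('g \<Rightarrow> 'a \<Rightarrow> 'a) \<Rightarrow> bool" where
  "restricts_to G A \<iota> C \<theta> D \<alpha> \<longleftrightarrow>
    (\<forall>g\<in>carrier G. C g \<inter> \<iota> ` carrier A = \<iota> ` D g \<and>
      (\<forall>a\<in>D (inv\<^bsub>G\<^esub> g). \<theta> g (\<iota> a) = \<iota> (\<alpha> g a)))"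

definition morita_equivalence_ii ::
    "('g, 'w) monoid_scheme \<Rightarrow> ('a, 'x) ring_scheme \<Rightarrow> ('b, 'y) ring_scheme \<Rightarrow>
     ('a, 'b, 'm, 'u) bimodule_scheme \<Rightarrow> ('b, 'a, 'n, 'v) bimodule_scheme \<Rightarrow>
     ('m \<Rightarrow> 'n \<Rightarrow> 'a) \<Rightarrow> ('n \<Rightarrow> 'm \<Rightarrow> 'b) \<Rightarrow> ('g \<Rightarrow> 'a set) \<Rightarrow> ('g \<Rightarrow> 'a \<Rightarrow> 'a) \<Rightarrow>
     ('g \<Rightarrow> 'b set) \<Rightarrow> ('g \<Rightarrow> 'b \<Rightarrow> 'b) \<Rightarrow> bool" where
  "morita_equivalence_ii G A A' M M' \<tau> \<tau>' D \<alpha> D' \<alpha>' \<longleftrightarrow>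
    (\<exists>C \<theta>. product_partial_action G (morita_ring A A' M M' \<tau> \<tau>') C \<theta> \<and>
      restricts_to G A (\<lambda>a. (a, \<zero>\<^bsub>M\<^esub>, \<zero>\<^bsub>M'\<^esub>, \<zero>\<^bsub>A'\<^esub>)) C \<theta> D \<alpha> \<and>
      restricts_to G A' (\<lambda>b. (\<zero>\<^bsub>A\<^esub>, \<zero>\<^bsub>M\<^esub>, \<zero>\<^bsub>M'\<^esub>, b)) C \<theta> D' \<alpha>')"

text \<open>
  The partial actions are Morita equivalent by means of the given context: it satisfies (i), and
  its own Morita ring carries the product partial action of (ii).  (Two partial actions are Morita
  equivalent if this holds for some context; the existential closure over \<open>M\<close> and \<open>M'\<close> of
  arbitrary type is not a single formula of HOL.)  A context for Morita equivalent partial actions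
  may satisfy (i) without satisfying (ii): let \<open>M\<close> be a field with one of the two scalar
  multiplications twisted by an automorphism that does not commute with the action.
\<close>

definition morita_equivalent_via ::
    "('g, 'w) monoid_scheme \<Rightarrow> ('a, 'x) ring_scheme \<Rightarrow> ('b, 'y) ring_scheme \<Rightarrow>
     ('a, 'b, 'm, 'u) bimodule_scheme \<Rightarrow> ('b, 'a, 'n, 'v) bimodule_scheme \<Rightarrow>
     ('m \<Rightarrow> 'n \<Rightarrow> 'a) \<Rightarrow> ('n \<Rightarrow> 'm \<Rightarrow> 'b) \<Rightarrow> ('g \<Rightarrow> 'a set) \<Rightarrow> ('g \<Rightarrow> 'a \<Rightarrow> 'a) \<Rightarrow>
     ('g \<Rightarrow> 'b set) \<Rightarrow> ('g \<Rightarrow> 'b \<Rightarrow> 'b) \<Rightarrow> bool" where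
  "morita_equivalent_via G A A' M M' \<tau> \<tau>' D \<alpha> D' \<alpha>' \<longleftrightarrow>
    morita_equivalence_i G A A' M M' \<tau> \<tau>' D D' \<and>
    morita_equivalence_ii G A A' M M' \<tau> \<tau>' D \<alpha> D' \<alpha>'"


section \<open>Data for a Morita ring\<close>

text \<open>
  The entries of the Morita ring have four different types, so statements about all
  \<open>i, j, k \<in> {1, 2}\<close> are written out.  The domain \<open>D\<^sup>(\<^sup>i\<^sup>)\<^sub>g M\<^sub>i\<^sub>j\<close> is
  \<open>left_dom M\<^sub>i\<^sub>j (left action) D\<^sup>(\<^sup>i\<^sup>) g\<close>, where the left and right actions on \<open>M\<^sub>i\<^sub>i = R\<^sub>i\<close> are the
  multiplication.
\<close>

definition left_dom ::
    "('m, 'z) ring_scheme \<Rightarrow> ('a \<Rightarrow> 'm \<Rightarrow> 'm) \<Rightarrow> ('g \<Rightarrow> 'a set) \<Rightarrow> 'g \<Rightarrow> 'm set" where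
  "left_dom M l D g = set_product M l (D g) (carrier M)"

definition right_dom ::
    "('m, 'z) ring_scheme \<Rightarrow> ('m \<Rightarrow> 'b \<Rightarrow> 'm) \<Rightarrow> ('g \<Rightarrow> 'b set) \<Rightarrow> 'g \<Rightarrow> 'm set" where
  "right_dom M r D g = set_product M r (carrier M) (D g)"

text \<open>
  The conditions on \<open>\<gamma>\<^sup>(\<^sup>i\<^sup>j\<^sup>)\<close> alone, for \<open>M = M\<^sub>i\<^sub>j\<close> and \<open>P g = D\<^sup>(\<^sup>i\<^sup>)\<^sub>g M\<^sub>i\<^sub>j\<close>.
\<close>

definition datum_component ::
    "('g, 'w) monoid_scheme \<Rightarrow> ('m, 'z) ring_scheme \<Rightarrow> ('g \<Rightarrow> 'm set) \<Rightarrow>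
     ('g \<Rightarrow> 'm \<Rightarrow> 'm) \<Rightarrow> bool" where
  "datum_component G M P \<gamma> \<longleftrightarrow>
    (\<forall>g\<in>carrier G. bij_betw (\<gamma> g) (P (inv\<^bsub>G\<^esub> g)) (P g) \<and>
      (\<forall>u\<in>P (inv\<^bsub>G\<^esub> g). \<forall>v\<in>P (inv\<^bsub>G\<^esub> g). \<gamma> g (u \<oplus>\<^bsub>M\<^esub> v) = \<gamma> g u \<oplus>\<^bsub>M\<^esub> \<gamma> g v)) \<and>
    (\<forall>u\<in>carrier M. \<gamma> \<one>\<^bsub>G\<^esub> u = u) \<and>
    (\<forall>g\<in>carrier G. \<forall>h\<in>carrier G.
      \<forall>a\<in>P (inv\<^bsub>G\<^esub> h). \<gamma> h a \<in> P (inv\<^bsub>G\<^esub> g) \<inter> P h \<longrightarrow>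
        a \<in> P (inv\<^bsub>G\<^esub> (g \<otimes>\<^bsub>G\<^esub> h)) \<and> \<gamma> g (\<gamma> h a) = \<gamma> (g \<otimes>\<^bsub>G\<^esub> h) a)"

text \<open>
  Compatibility of \<open>\<gamma>\<^sup>(\<^sup>i\<^sup>k\<^sup>)\<close>, \<open>\<gamma>\<^sup>(\<^sup>k\<^sup>j\<^sup>)\<close>, \<open>\<gamma>\<^sup>(\<^sup>i\<^sup>j\<^sup>)\<close> with the product \<open>f\<close> from
  \<open>M\<^sub>i\<^sub>k\<close> and \<open>M\<^sub>k\<^sub>j\<close> to \<open>M\<^sub>i\<^sub>j\<close>, where \<open>P g = D\<^sup>(\<^sup>i\<^sup>)\<^sub>g M\<^sub>i\<^sub>k\<close> and \<open>Q g = D\<^sup>(\<^sup>k\<^sup>)\<^sub>g M\<^sub>k\<^sub>j\<close>.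
\<close>

definition datum_mult ::
    "('g, 'w) monoid_scheme \<Rightarrow> ('m \<Rightarrow> 'n \<Rightarrow> 'p) \<Rightarrow> ('g \<Rightarrow> 'm set) \<Rightarrow> ('g \<Rightarrow> 'n set) \<Rightarrow>
     ('g \<Rightarrow> 'm \<Rightarrow> 'm) \<Rightarrow> ('g \<Rightarrow> 'n \<Rightarrow> 'n) \<Rightarrow> ('g \<Rightarrow> 'p \<Rightarrow> 'p) \<Rightarrow> bool" where
  "datum_mult G f P Q \<gamma>\<^sub>i\<^sub>k \<gamma>\<^sub>k\<^sub>j \<gamma>\<^sub>i\<^sub>j \<longleftrightarrow>
    (\<forall>g\<in>carrier G. \<forall>u\<in>P (inv\<^bsub>G\<^esub> g). \<forall>v\<in>Q (inv\<^bsub>G\<^esub> g).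
      f (\<gamma>\<^sub>i\<^sub>k g u) (\<gamma>\<^sub>k\<^sub>j g v) = \<gamma>\<^sub>i\<^sub>j g (f u v))"

definition datum ::
    "('k, 'c) ring_scheme \<Rightarrow> ('g, 'w) monoid_scheme \<Rightarrow>
     ('k, 'a, 'x) module_scheme \<Rightarrow> ('k, 'b, 'y) module_scheme \<Rightarrow>
     ('a, 'b, 'm, 'u) bimodule_scheme \<Rightarrow> ('b, 'a, 'n, 'v) bimodule_scheme \<Rightarrow>
     ('m \<Rightarrow> 'n \<Rightarrow> 'a) \<Rightarrow> ('n \<Rightarrow> 'm \<Rightarrow> 'b) \<Rightarrow>
     ('g \<Rightarrow> 'a set) \<Rightarrow> ('g \<Rightarrow> 'a \<Rightarrow> 'a) \<Rightarrow> ('g \<Rightarrow> 'b set) \<Rightarrow> ('g \<Rightarrow> 'b \<Rightarrow> 'b) \<Rightarrow>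
     ('g \<Rightarrow> 'a \<Rightarrow> 'a) \<Rightarrow> ('g \<Rightarrow> 'm \<Rightarrow> 'm) \<Rightarrow> ('g \<Rightarrow> 'n \<Rightarrow> 'n) \<Rightarrow> ('g \<Rightarrow> 'b \<Rightarrow> 'b) \<Rightarrow> bool" where
  "datum K G R\<^sub>1 R\<^sub>2 M\<^sub>1\<^sub>2 M\<^sub>2\<^sub>1 \<tau>\<^sub>1\<^sub>2 \<tau>\<^sub>2\<^sub>1 D\<^sub>1 \<alpha>\<^sub>1 D\<^sub>2 \<alpha>\<^sub>2 \<gamma>\<^sub>1\<^sub>1 \<gamma>\<^sub>1\<^sub>2 \<gamma>\<^sub>2\<^sub>1 \<gamma>\<^sub>2\<^sub>2 \<longleftrightarrow>
    (let P\<^sub>1\<^sub>1 = left_dom R\<^sub>1 (\<otimes>\<^bsub>R\<^sub>1\<^esub>) D\<^sub>1;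
         P\<^sub>1\<^sub>2 = left_dom M\<^sub>1\<^sub>2 (lsmult M\<^sub>1\<^sub>2) D\<^sub>1;
         P\<^sub>2\<^sub>1 = left_dom M\<^sub>2\<^sub>1 (lsmult M\<^sub>2\<^sub>1) D\<^sub>2;
         P\<^sub>2\<^sub>2 = left_dom R\<^sub>2 (\<otimes>\<^bsub>R\<^sub>2\<^esub>) D\<^sub>2
     in
      algebra_partial_action K G R\<^sub>1 D\<^sub>1 \<alpha>\<^sub>1 \<and>
      algebra_partial_action K G R\<^sub>2 D\<^sub>2 \<alpha>\<^sub>2 \<and>
      (\<forall>g\<in>carrier G.
        P\<^sub>1\<^sub>1 g = right_dom R\<^sub>1 (\<otimes>\<^bsub>R\<^sub>1\<^esub>) D\<^sub>1 g \<and>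
        P\<^sub>1\<^sub>2 g = right_dom M\<^sub>1\<^sub>2 (rsmult M\<^sub>1\<^sub>2) D\<^sub>2 g \<and>
        P\<^sub>2\<^sub>1 g = right_dom M\<^sub>2\<^sub>1 (rsmult M\<^sub>2\<^sub>1) D\<^sub>1 g \<and>
        P\<^sub>2\<^sub>2 g = right_dom R\<^sub>2 (\<otimes>\<^bsub>R\<^sub>2\<^esub>) D\<^sub>2 g) \<and>
      (\<forall>g\<in>carrier G.
        (\<forall>u\<in>P\<^sub>1\<^sub>1 (inv\<^bsub>G\<^esub> g). \<gamma>\<^sub>1\<^sub>1 g u = \<alpha>\<^sub>1 g u) \<and>
        (\<forall>u\<in>P\<^sub>2\<^sub>2 (inv\<^bsub>G\<^esub> g). \<gamma>\<^sub>2\<^sub>2 g u = \<alpha>\<^sub>2 g u)) \<and>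
      datum_component G R\<^sub>1 P\<^sub>1\<^sub>1 \<gamma>\<^sub>1\<^sub>1 \<and>
      datum_component G M\<^sub>1\<^sub>2 P\<^sub>1\<^sub>2 \<gamma>\<^sub>1\<^sub>2 \<and>
      datum_component G M\<^sub>2\<^sub>1 P\<^sub>2\<^sub>1 \<gamma>\<^sub>2\<^sub>1 \<and>
      datum_component G R\<^sub>2 P\<^sub>2\<^sub>2 \<gamma>\<^sub>2\<^sub>2 \<and>
      datum_mult G (\<otimes>\<^bsub>R\<^sub>1\<^esub>) P\<^sub>1\<^sub>1 P\<^sub>1\<^sub>1 \<gamma>\<^sub>1\<^sub>1 \<gamma>\<^sub>1\<^sub>1 \<gamma>\<^sub>1\<^sub>1 \<and>
      datum_mult G \<tau>\<^sub>1\<^sub>2 P\<^sub>1\<^sub>2 P\<^sub>2\<^sub>1 \<gamma>\<^sub>1\<^sub>2 \<gamma>\<^sub>2\<^sub>1 \<gamma>\<^sub>1\<^sub>1 \<and>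
      datum_mult G (lsmult M\<^sub>1\<^sub>2) P\<^sub>1\<^sub>1 P\<^sub>1\<^sub>2 \<gamma>\<^sub>1\<^sub>1 \<gamma>\<^sub>1\<^sub>2 \<gamma>\<^sub>1\<^sub>2 \<and>
      datum_mult G (rsmult M\<^sub>1\<^sub>2) P\<^sub>1\<^sub>2 P\<^sub>2\<^sub>2 \<gamma>\<^sub>1\<^sub>2 \<gamma>\<^sub>2\<^sub>2 \<gamma>\<^sub>1\<^sub>2 \<and>
      datum_mult G (rsmult M\<^sub>2\<^sub>1) P\<^sub>2\<^sub>1 P\<^sub>1\<^sub>1 \<gamma>\<^sub>2\<^sub>1 \<gamma>\<^sub>1\<^sub>1 \<gamma>\<^sub>2\<^sub>1 \<and>
      datum_mult G (lsmult M\<^sub>2\<^sub>1) P\<^sub>2\<^sub>2 P\<^sub>2\<^sub>1 \<gamma>\<^sub>2\<^sub>2 \<gamma>\<^sub>2\<^sub>1 \<gamma>\<^sub>2\<^sub>1 \<and>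
      datum_mult G \<tau>\<^sub>2\<^sub>1 P\<^sub>2\<^sub>1 P\<^sub>1\<^sub>2 \<gamma>\<^sub>2\<^sub>1 \<gamma>\<^sub>1\<^sub>2 \<gamma>\<^sub>2\<^sub>2 \<and>
      datum_mult G (\<otimes>\<^bsub>R\<^sub>2\<^esub>) P\<^sub>2\<^sub>2 P\<^sub>2\<^sub>2 \<gamma>\<^sub>2\<^sub>2 \<gamma>\<^sub>2\<^sub>2 \<gamma>\<^sub>2\<^sub>2)"

end

theory Submission
  imports Defs
begin

text \<open>
  Let \<open>\<R>\<close> be the Morita ring, \<open>\<theta>\<close> the product partial action on it with domains \<open>C g\<close>, and
  \<open>e\<^sub>1\<close>, \<open>e\<^sub>2\<close> the two diagonal idempotents.  The entries \<open>M\<^sub>i\<^sub>j\<close> are the Peirce components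
  \<open>e\<^sub>i \<R> e\<^sub>j\<close>, and the maps of the datum are the restrictions of \<open>\<theta> g\<close> to them.

  The domains are right: surjectivity of the pairings says that \<open>e\<^sub>j\<close> is a sum of products \<open>y x\<close>
  with \<open>y \<in> M\<^sub>j\<^sub>i\<close> and \<open>x \<in> M\<^sub>i\<^sub>j\<close>.  Hence every \<open>u = u e\<^sub>j\<close> in \<open>C g \<inter> M\<^sub>i\<^sub>j\<close> is a sum of elements
  \<open>(u y) x\<close> with \<open>u y \<in> C g \<inter> R\<^sub>i = D\<^sub>i g\<close>, so that \<open>C g \<inter> M\<^sub>i\<^sub>j = D\<^sub>i g M\<^sub>i\<^sub>j\<close>; symmetrically it is
  \<open>M\<^sub>i\<^sub>j D\<^sub>j g\<close> (\<open>ideal_peirce_left\<close>, \<open>ideal_peirce_right\<close>).  So the left and the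
  right domains agree.

  The map \<open>\<theta> g\<close> respects the Peirce decomposition: by assumption it maps the diagonal corners to
  themselves, and regularity gives \<open>D\<^sub>i D\<^sub>i = D\<^sub>i\<close>, where \<open>D\<^sub>i = D\<^sub>i (inv g)\<close>
  and \<open>C = C (inv g)\<close>.  An element of \<open>C \<inter> M\<^sub>i\<^sub>j\<close> is therefore a sum of
  products \<open>d x\<close> with \<open>d \<in> D\<^sub>i\<close> and \<open>x \<in> C\<close>, whose images \<open>\<theta> d \<cdot> \<theta> x\<close> lie in \<open>e\<^sub>i \<R>\<close>; on the other
  side they lie in \<open>\<R> e\<^sub>j\<close> (\<open>act_peirce\<close>).  Additivity and multiplicativity of the restrictions are
  then inherited from \<open>\<theta>\<close>.

  Composition is where the intersection hypothesis enters.  The partial action law asks for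
  \<open>\<theta> g \<circ> \<theta> h = \<theta> (g h)\<close> where \<open>\<theta> h\<close> lands in an intersection of domains, while \<open>\<theta>\<close> only grants it where
  \<open>\<theta> h\<close> lands in a product of domains (\<open>act_comp_product\<close>).  The hypothesis and regularity close the
  gap: \<open>D\<^sub>i h M\<^sub>i\<^sub>j \<inter> D\<^sub>i (inv g) M\<^sub>i\<^sub>j = (D\<^sub>i h \<inter> D\<^sub>i (inv g)) M\<^sub>i\<^sub>j = D\<^sub>i h (D\<^sub>i (inv g) M\<^sub>i\<^sub>j)\<close>, which is
  contained in \<open>C h C (inv g)\<close> (\<open>chart_intersection\<close>).

  All of this is carried out for a pair of elements \<open>e\<close>, \<open>f\<close> of one ring, so that the four index pairs
  are instances of a single argument; the modules \<open>M\<^sub>i\<^sub>j\<close>, which have different types, are connected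
  to it by the embeddings \<open>M\<^sub>i\<^sub>j \<rightarrow> \<R>\<close>.
\<close>

section \<open>Products of additive subgroups\<close>

lemma set_product_mem: "\<lbrakk>s \<in> S; t \<in> T\<rbrakk> \<Longrightarrow> f s t \<in> set_product Z f S T"
  unfolding set_product_def by (rule generate.incl) blast

lemma set_product_least:
  assumes "abelian_group Z" "additive_subgroup H Z" "\<And>s t. \<lbrakk>s \<in> S; t \<in> T\<rbrakk> \<Longrightarrow> f s t \<in> H"
  shows "set_product Z f S T \<subseteq> H"
  unfolding set_product_def
  using assms(3)
  by (intro group.generate_subgroup_incl[OF abelian_group.a_group[OF assms(1)]
        _ additive_subgroup.a_subgroup[OF assms(2)]]) auto

lemma set_product_subgroup:
  assumes "abelian_group Z" "\<And>s t. \<lbrakk>s \<in> S; t \<in> T\<rbrakk> \<Longrightarrow> f s t \<in> carrier Z"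
  shows "additive_subgroup (set_product Z f S T) Z"
  unfolding set_product_def additive_subgroup_def
  using assms(2)
  by (intro group.generate_is_subgroup[OF abelian_group.a_group[OF assms(1)]]) auto

lemma set_product_mono:
  assumes "abelian_group Z" "S \<subseteq> S'" "T \<subseteq> T'" "\<And>s t. \<lbrakk>s \<in> S'; t \<in> T'\<rbrakk> \<Longrightarrow> f s t \<in> carrier Z"
  shows "set_product Z f S T \<subseteq> set_product Z f S' T'"
proof (rule set_product_least[OF assms(1) set_product_subgroup[OF assms(1,4)]])
  show "\<And>s t. \<lbrakk>s \<in> S; t \<in> T\<rbrakk> \<Longrightarrow> f s t \<in> set_product Z f S' T'"
    using assms(2,3) by (intro set_product_mem) auto
qed

lemma image_set_product:
  assumes Z: "abelian_group Z" and Z': "abelian_group Z'"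
    and closed: "\<And>s t. \<lbrakk>s \<in> S; t \<in> T\<rbrakk> \<Longrightarrow> f s t \<in> carrier Z"
    and \<iota>_closed: "\<And>x. x \<in> carrier Z \<Longrightarrow> \<iota> x \<in> carrier Z'"
    and \<iota>_add: "\<And>x y. \<lbrakk>x \<in> carrier Z; y \<in> carrier Z\<rbrakk> \<Longrightarrow> \<iota> (x \<oplus>\<^bsub>Z\<^esub> y) = \<iota> x \<oplus>\<^bsub>Z'\<^esub> \<iota> y"
    and mult: "\<And>s t. \<lbrakk>s \<in> S; t \<in> T\<rbrakk> \<Longrightarrow> \<iota> (f s t) = f' (\<kappa> s) (\<mu> t)"
  shows "\<iota> ` set_product Z f S T = set_product Z' f' (\<kappa> ` S) (\<mu> ` T)"
proof -
  let ?P = "{f s t | s t. s \<in> S \<and> t \<in> T}"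
  have "group_hom (add_monoid Z) (add_monoid Z') \<iota>"
    using Z Z' \<iota>_closed \<iota>_add
    by (intro group_hom.intro group_hom_axioms.intro abelian_group.a_group homI) auto
  then have "\<iota> ` generate (add_monoid Z) ?P = generate (add_monoid Z') (\<iota> ` ?P)"
    using closed by (intro group_hom.generate_img[symmetric]) auto
  moreover have "\<iota> ` ?P = {f' s t | s t. s \<in> \<kappa> ` S \<and> t \<in> \<mu> ` T}"
  proof (intro subset_antisym subsetI)
    fix z assume "z \<in> \<iota> ` ?P"
    then show "z \<in> {f' s t | s t. s \<in> \<kappa> ` S \<and> t \<in> \<mu> ` T}" using mult by auto
  next
    fix z assume "z \<in> {f' s t | s t. s \<in> \<kappa> ` S \<and> t \<in> \<mu> ` T}"
    then obtain s t where "s \<in> S" "t \<in> T" "z = \<iota> (f s t)" using mult by auto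
    then show "z \<in> \<iota> ` ?P" by blast
  qed
  ultimately show ?thesis unfolding set_product_def by simp
qed

context ring
begin

lemma set_product_ring_mem: "\<lbrakk>s \<in> S; t \<in> T\<rbrakk> \<Longrightarrow> s \<otimes> t \<in> set_product R (\<otimes>) S T"
  by (rule set_product_mem)

lemma additive_subgroupI:
  assumes "H \<subseteq> carrier R" "\<zero> \<in> H" "\<And>a. a \<in> H \<Longrightarrow> \<ominus> a \<in> H"
    "\<And>a b. \<lbrakk>a \<in> H; b \<in> H\<rbrakk> \<Longrightarrow> a \<oplus> b \<in> H"
  shows "additive_subgroup H R"
  unfolding additive_subgroup_def using assms by (intro add.subgroupI) auto

lemma additive_subgroup_left_quotient:
  assumes "additive_subgroup H R" "x \<in> carrier R"
  shows "additive_subgroup {z \<in> carrier R. x \<otimes> z \<in> H} R"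
  using assms additive_subgroup.zero_closed[OF assms(1)]
  by (intro additive_subgroupI)
    (auto simp: r_minus r_distr intro!: additive_subgroup.a_inv_closed additive_subgroup.a_closed)

lemma additive_subgroup_right_quotient:
  assumes "additive_subgroup H R" "x \<in> carrier R"
  shows "additive_subgroup {z \<in> carrier R. z \<otimes> x \<in> H} R"
  using assms additive_subgroup.zero_closed[OF assms(1)]
  by (intro additive_subgroupI)
    (auto simp: l_minus l_distr intro!: additive_subgroup.a_inv_closed additive_subgroup.a_closed)

text \<open>
  An element \<open>x\<close> multiplies all of \<open>S T\<close> into \<open>H\<close> as soon as it does so for the generators
  \<open>s t\<close>, because the elements with this property form an additive subgroup.
\<close>

lemma mult_set_product:
  assumes "additive_subgroup H R" "x \<in> carrier R" "S \<subseteq> carrier R" "T \<subseteq> carrier R"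
    and "z \<in> set_product R (\<otimes>) S T"
    and "\<And>s t. \<lbrakk>s \<in> S; t \<in> T\<rbrakk> \<Longrightarrow> x \<otimes> (s \<otimes> t) \<in> H"
  shows "x \<otimes> z \<in> H"
proof -
  have "set_product R (\<otimes>) S T \<subseteq> {z \<in> carrier R. x \<otimes> z \<in> H}"
    using assms
    by (intro set_product_least[OF is_abelian_group] additive_subgroup_left_quotient) auto
  with assms(5) show ?thesis by blast
qed

lemma set_product_mult:
  assumes "additive_subgroup H R" "x \<in> carrier R" "S \<subseteq> carrier R" "T \<subseteq> carrier R"
    and "z \<in> set_product R (\<otimes>) S T"
    and "\<And>s t. \<lbrakk>s \<in> S; t \<in> T\<rbrakk> \<Longrightarrow> (s \<otimes> t) \<otimes> x \<in> H"
  shows "z \<otimes> x \<in> H"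
proof -
  have "set_product R (\<otimes>) S T \<subseteq> {z \<in> carrier R. z \<otimes> x \<in> H}"
    using assms
    by (intro set_product_least[OF is_abelian_group] additive_subgroup_right_quotient) auto
  with assms(5) show ?thesis by blast
qed

lemma set_product_ring_subgroup:
  "\<lbrakk>S \<subseteq> carrier R; T \<subseteq> carrier R\<rbrakk> \<Longrightarrow> additive_subgroup (set_product R (\<otimes>) S T) R"
  by (intro set_product_subgroup[OF is_abelian_group]) auto

lemma set_product_in_carrier:
  "\<lbrakk>S \<subseteq> carrier R; T \<subseteq> carrier R\<rbrakk> \<Longrightarrow> set_product R (\<otimes>) S T \<subseteq> carrier R"
  by (rule additive_subgroup.a_subset[OF set_product_ring_subgroup])

lemma set_product_ring_mono:
  "\<lbrakk>S \<subseteq> S'; T \<subseteq> T'; S' \<subseteq> carrier R; T' \<subseteq> carrier R\<rbrakk> \<Longrightarrow>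
    set_product R (\<otimes>) S T \<subseteq> set_product R (\<otimes>) S' T'"
  by (intro set_product_mono[OF is_abelian_group]) auto

lemma set_product_assoc_subset:
  assumes "S \<subseteq> carrier R" "T \<subseteq> carrier R" "U \<subseteq> carrier R"
  shows "set_product R (\<otimes>) (set_product R (\<otimes>) S T) U \<subseteq>
      set_product R (\<otimes>) S (set_product R (\<otimes>) T U)"
proof (rule set_product_least[OF is_abelian_group])
  show sub: "additive_subgroup (set_product R (\<otimes>) S (set_product R (\<otimes>) T U)) R"
    using assms by (intro set_product_ring_subgroup set_product_in_carrier)
  fix z u assume "z \<in> set_product R (\<otimes>) S T" "u \<in> U"
  moreover have "(s \<otimes> t) \<otimes> u \<in> set_product R (\<otimes>) S (set_product R (\<otimes>) T U)"
    if "s \<in> S" "t \<in> T" for s t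
  proof -
    have "(s \<otimes> t) \<otimes> u = s \<otimes> (t \<otimes> u)" using that \<open>u \<in> U\<close> assms by (intro m_assoc) auto
    then show ?thesis using that \<open>u \<in> U\<close> by (auto intro: set_product_ring_mem)
  qed
  ultimately show "z \<otimes> u \<in> set_product R (\<otimes>) S (set_product R (\<otimes>) T U)"
    using assms by - (rule set_product_mult[OF sub], auto)
qed

lemma set_product_assoc_superset:
  assumes "S \<subseteq> carrier R" "T \<subseteq> carrier R" "U \<subseteq> carrier R"
  shows "set_product R (\<otimes>) S (set_product R (\<otimes>) T U) \<subseteq>
      set_product R (\<otimes>) (set_product R (\<otimes>) S T) U"
proof (rule set_product_least[OF is_abelian_group])
  show sub: "additive_subgroup (set_product R (\<otimes>) (set_product R (\<otimes>) S T) U) R"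
    using assms by (intro set_product_ring_subgroup set_product_in_carrier)
  fix s z assume "s \<in> S" "z \<in> set_product R (\<otimes>) T U"
  moreover have "s \<otimes> (t \<otimes> u) \<in> set_product R (\<otimes>) (set_product R (\<otimes>) S T) U"
    if "t \<in> T" "u \<in> U" for t u
  proof -
    have "s \<otimes> (t \<otimes> u) = (s \<otimes> t) \<otimes> u" using that \<open>s \<in> S\<close> assms by (intro m_assoc[symmetric]) auto
    then show ?thesis using that \<open>s \<in> S\<close> by (auto intro: set_product_ring_mem)
  qed
  ultimately show "s \<otimes> z \<in> set_product R (\<otimes>) (set_product R (\<otimes>) S T) U"
    using assms by - (rule mult_set_product[OF sub], auto)
qed

end

section \<open>Peirce components\<close>

text \<open>For idempotents \<open>e\<close> and \<open>f\<close> this is \<open>e R f\<close>.\<close>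

definition peirce :: "('r, 'z) ring_scheme \<Rightarrow> 'r \<Rightarrow> 'r \<Rightarrow> 'r set" where
  "peirce R e f = {x \<in> carrier R. e \<otimes>\<^bsub>R\<^esub> x = x \<and> x \<otimes>\<^bsub>R\<^esub> f = x}"

context ring
begin

lemma peirce_subset: "peirce R e f \<subseteq> carrier R"
  by (auto simp: peirce_def)

lemma peirce_mult:
  "\<lbrakk>e \<in> carrier R; f' \<in> carrier R; x \<in> peirce R e f; y \<in> peirce R f f'\<rbrakk> \<Longrightarrow> x \<otimes> y \<in> peirce R e f'"
  by (auto simp: peirce_def m_assoc) (simp add: m_assoc[symmetric])

lemma peirce_subgroup:
  assumes "e \<in> carrier R" "f \<in> carrier R"
  shows "additive_subgroup (peirce R e f) R"
  using assms
  by (intro additive_subgroupI) (auto simp: peirce_def r_minus l_minus r_distr l_distr)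

lemma ideal_peirce_subgroup:
  assumes "ideal I R" "e \<in> carrier R" "f \<in> carrier R"
  shows "additive_subgroup (I \<inter> peirce R e f) R"
proof -
  interpret I: ideal I R by fact
  interpret P: additive_subgroup "peirce R e f" R using assms by (intro peirce_subgroup)
  show ?thesis
    using peirce_subset by (intro additive_subgroupI) (auto intro: I.a_inv_closed P.a_inv_closed)
qed

text \<open>
  If \<open>f\<close> is a sum of products \<open>y x\<close> with \<open>y \<in> f R e\<close> and \<open>x \<in> e R f\<close>, then any \<open>u \<in> I \<inter> e R f\<close> is
  the sum of the \<open>(u y) x\<close>, and \<open>u y\<close> lies in \<open>I \<inter> e R e\<close>.
\<close>

lemma ideal_peirce_left:
  assumes I: "ideal I R" and e: "e \<in> carrier R" and f: "f \<in> carrier R"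
    and full: "f \<in> set_product R (\<otimes>) (peirce R f e) (peirce R e f)"
  shows "I \<inter> peirce R e f = set_product R (\<otimes>) (I \<inter> peirce R e e) (peirce R e f)"
    (is "_ = ?SP")
proof
  interpret I: ideal I R by fact
  have sub: "additive_subgroup ?SP R"
    using peirce_subset by (intro set_product_ring_subgroup) auto
  show "I \<inter> peirce R e f \<subseteq> ?SP"
  proof
    fix u assume u: "u \<in> I \<inter> peirce R e f"
    have "u \<otimes> f \<in> ?SP"
    proof (rule mult_set_product[OF sub _ _ _ full])
      fix y x assume yx: "y \<in> peirce R f e" "x \<in> peirce R e f"
      have "u \<otimes> (y \<otimes> x) = (u \<otimes> y) \<otimes> x"
        using u yx peirce_subset by (intro m_assoc[symmetric]) auto
      moreover have "u \<otimes> y \<in> I \<inter> peirce R e e"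
        using u yx e peirce_subset by (auto intro: peirce_mult I.I_r_closed)
      ultimately show "u \<otimes> (y \<otimes> x) \<in> ?SP" using yx by (auto intro: set_product_ring_mem)
    qed (use u peirce_subset in auto)
    then show "u \<in> ?SP" using u by (simp add: peirce_def)
  qed
  show "?SP \<subseteq> I \<inter> peirce R e f"
    using peirce_subset e f
    by (intro set_product_least[OF is_abelian_group ideal_peirce_subgroup[OF I]])
      (auto intro: peirce_mult I.I_r_closed)
qed

lemma ideal_peirce_right:
  assumes I: "ideal I R" and e: "e \<in> carrier R" and f: "f \<in> carrier R"
    and full: "e \<in> set_product R (\<otimes>) (peirce R e f) (peirce R f e)"
  shows "I \<inter> peirce R e f = set_product R (\<otimes>) (peirce R e f) (I \<inter> peirce R f f)"
    (is "_ = ?SP")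
proof
  interpret I: ideal I R by fact
  have sub: "additive_subgroup ?SP R"
    using peirce_subset by (intro set_product_ring_subgroup) auto
  show "I \<inter> peirce R e f \<subseteq> ?SP"
  proof
    fix u assume u: "u \<in> I \<inter> peirce R e f"
    have "e \<otimes> u \<in> ?SP"
    proof (rule set_product_mult[OF sub _ _ _ full])
      fix y x assume yx: "y \<in> peirce R e f" "x \<in> peirce R f e"
      have "(y \<otimes> x) \<otimes> u = y \<otimes> (x \<otimes> u)"
        using u yx peirce_subset by (intro m_assoc) auto
      moreover have "x \<otimes> u \<in> I \<inter> peirce R f f"
        using u yx f peirce_subset by (auto intro: peirce_mult I.I_l_closed)
      ultimately show "(y \<otimes> x) \<otimes> u \<in> ?SP" using yx by (auto intro: set_product_ring_mem)
    qed (use u peirce_subset in auto)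
    then show "u \<in> ?SP" using u by (simp add: peirce_def)
  qed
  show "?SP \<subseteq> I \<inter> peirce R e f"
    using peirce_subset e f
    by (intro set_product_least[OF is_abelian_group ideal_peirce_subgroup[OF I]])
      (auto intro: peirce_mult I.I_l_closed)
qed

end


section \<open>Product partial actions and idempotents\<close>

context product_partial_action
begin

lemma dom_subset: "g \<in> carrier G \<Longrightarrow> D g \<subseteq> carrier A"
  by (rule ideal.Icarr[OF dom_ideal, THEN subsetI])

lemma act_closed: "\<lbrakk>g \<in> carrier G; a \<in> D (inv\<^bsub>G\<^esub> g)\<rbrakk> \<Longrightarrow> \<theta> g a \<in> D g"
  using act_iso[of g] by (auto simp: ideal_iso_def bij_betw_def)

lemma act_add: "\<lbrakk>g \<in> carrier G; a \<in> D (inv\<^bsub>G\<^esub> g); b \<in> D (inv\<^bsub>G\<^esub> g)\<rbrakk> \<Longrightarrow>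
    \<theta> g (a \<oplus>\<^bsub>A\<^esub> b) = \<theta> g a \<oplus>\<^bsub>A\<^esub> \<theta> g b"
  using act_iso[of g] by (auto simp: ideal_iso_def)

lemma act_mult: "\<lbrakk>g \<in> carrier G; a \<in> D (inv\<^bsub>G\<^esub> g); b \<in> D (inv\<^bsub>G\<^esub> g)\<rbrakk> \<Longrightarrow>
    \<theta> g (a \<otimes>\<^bsub>A\<^esub> b) = \<theta> g a \<otimes>\<^bsub>A\<^esub> \<theta> g b"
  using act_iso[of g] by (auto simp: ideal_iso_def)

lemma act_zero:
  assumes g: "g \<in> carrier G"
  shows "\<theta> g \<zero>\<^bsub>A\<^esub> = \<zero>\<^bsub>A\<^esub>"
proof -
  interpret I: ideal "D (inv\<^bsub>G\<^esub> g)" A using g by (intro dom_ideal) simp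
  have "\<theta> g \<zero>\<^bsub>A\<^esub> \<in> carrier A" using act_closed[OF g I.zero_closed] dom_subset[OF g] by auto
  moreover have "\<theta> g \<zero>\<^bsub>A\<^esub> \<oplus>\<^bsub>A\<^esub> \<theta> g \<zero>\<^bsub>A\<^esub> = \<theta> g \<zero>\<^bsub>A\<^esub>"
    using act_add[OF g I.zero_closed I.zero_closed] by simp
  ultimately show ?thesis by (simp add: A.add.l_cancel_one')
qed

lemma act_uminus:
  assumes g: "g \<in> carrier G" and a: "a \<in> D (inv\<^bsub>G\<^esub> g)"
  shows "\<theta> g (\<ominus>\<^bsub>A\<^esub> a) = \<ominus>\<^bsub>A\<^esub> \<theta> g a"
proof -
  interpret I: ideal "D (inv\<^bsub>G\<^esub> g)" A using g by (intro dom_ideal) simp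
  have m: "\<ominus>\<^bsub>A\<^esub> a \<in> D (inv\<^bsub>G\<^esub> g)" using a by (rule I.a_inv_closed)
  have "\<theta> g (\<ominus>\<^bsub>A\<^esub> a) \<oplus>\<^bsub>A\<^esub> \<theta> g a = \<zero>\<^bsub>A\<^esub>"
    using act_add[OF g m a] act_zero[OF g] I.Icarr[OF a] by (simp add: A.l_neg)
  then show ?thesis
    using act_closed[OF g a] act_closed[OF g m] dom_subset[OF g]
    by (intro A.minus_equality[symmetric]) auto
qed

text \<open>
  Since \<open>A\<close> is unital, \<open>D (inv g) = D (inv g) D \<one>\<close>, so \<open>act_comp\<close> applies to \<open>inv g\<close> and \<open>g\<close> on the
  whole domain of \<open>\<theta> g\<close>.
\<close>

lemma act_inv_act:
  assumes g: "g \<in> carrier G" and a: "a \<in> D (inv\<^bsub>G\<^esub> g)"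
  shows "\<theta> (inv\<^bsub>G\<^esub> g) (\<theta> g a) = a"
proof -
  interpret I: ideal "D (inv\<^bsub>G\<^esub> g)" A using g by (intro dom_ideal) simp
  have "a \<otimes>\<^bsub>A\<^esub> \<one>\<^bsub>A\<^esub> \<in> set_product A (\<otimes>\<^bsub>A\<^esub>) (D (inv\<^bsub>G\<^esub> g)) (carrier A)"
    using a by (intro set_product_mem) auto
  then have "a \<in> set_product A (\<otimes>\<^bsub>A\<^esub>) (D (inv\<^bsub>G\<^esub> g)) (D (inv\<^bsub>G\<^esub> (inv\<^bsub>G\<^esub> g \<otimes>\<^bsub>G\<^esub> g)))"
    using a g I.Icarr by (simp add: dom_one)
  with g have "\<theta> (inv\<^bsub>G\<^esub> g) (\<theta> g a) = \<theta> (inv\<^bsub>G\<^esub> g \<otimes>\<^bsub>G\<^esub> g) a"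
    by (intro act_comp) auto
  then show ?thesis using g a I.Icarr by (simp add: act_one)
qed

text \<open>
  Where the product partial action composes: by \<open>act_dom\<close>, the inverse image of \<open>D h D (inv g)\<close>
  under \<open>\<theta> h\<close> is \<open>D (inv h) D (inv (g h))\<close>, the domain on which \<open>act_comp\<close> applies.
\<close>

lemma act_comp_product:
  assumes g: "g \<in> carrier G" and h: "h \<in> carrier G" and a: "a \<in> D (inv\<^bsub>G\<^esub> h)"
    and ha: "\<theta> h a \<in> set_product A (\<otimes>\<^bsub>A\<^esub>) (D h) (D (inv\<^bsub>G\<^esub> g))"
  shows "a \<in> D (inv\<^bsub>G\<^esub> (g \<otimes>\<^bsub>G\<^esub> h))" "\<theta> g (\<theta> h a) = \<theta> (g \<otimes>\<^bsub>G\<^esub> h) a"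
proof -
  have inv: "inv\<^bsub>G\<^esub> h \<otimes>\<^bsub>G\<^esub> inv\<^bsub>G\<^esub> g = inv\<^bsub>G\<^esub> (g \<otimes>\<^bsub>G\<^esub> h)"
    using g h by (simp add: G.inv_mult_group)
  have "a \<in> \<theta> (inv\<^bsub>G\<^esub> h) ` set_product A (\<otimes>\<^bsub>A\<^esub>) (D h) (D (inv\<^bsub>G\<^esub> g))"
    using ha act_inv_act[OF h a] by force
  then have P: "a \<in> set_product A (\<otimes>\<^bsub>A\<^esub>) (D (inv\<^bsub>G\<^esub> h)) (D (inv\<^bsub>G\<^esub> (g \<otimes>\<^bsub>G\<^esub> h)))"
    using act_dom[of "inv\<^bsub>G\<^esub> h" "inv\<^bsub>G\<^esub> g"] g h by (simp add: inv)
  then show "\<theta> g (\<theta> h a) = \<theta> (g \<otimes>\<^bsub>G\<^esub> h) a" by (rule act_comp[OF g h])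
  interpret J: ideal "D (inv\<^bsub>G\<^esub> (g \<otimes>\<^bsub>G\<^esub> h))" A using g h by (intro dom_ideal) simp
  have "set_product A (\<otimes>\<^bsub>A\<^esub>) (D (inv\<^bsub>G\<^esub> h)) (D (inv\<^bsub>G\<^esub> (g \<otimes>\<^bsub>G\<^esub> h))) \<subseteq> D (inv\<^bsub>G\<^esub> (g \<otimes>\<^bsub>G\<^esub> h))"
    using dom_subset[of "inv\<^bsub>G\<^esub> h"] h
    by (intro set_product_least[OF A.is_abelian_group J.additive_subgroup_axioms])
      (auto intro: J.I_l_closed)
  with P show "a \<in> D (inv\<^bsub>G\<^esub> (g \<otimes>\<^bsub>G\<^esub> h))" by blast
qed

text \<open>
  A left identity of the images of the left factors is one of the images of all products, provided
  that both factors lie in the domain of \<open>\<theta> g\<close>: only then is \<open>\<theta> g (s t) = \<theta> g s \<cdot> \<theta> g t\<close> available.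
\<close>

lemma act_fixed_left:
  assumes g: "g \<in> carrier G" and e: "e \<in> carrier A"
    and S: "S \<subseteq> D (inv\<^bsub>G\<^esub> g)" and T: "T \<subseteq> D (inv\<^bsub>G\<^esub> g)"
    and fixed: "\<And>s. s \<in> S \<Longrightarrow> e \<otimes>\<^bsub>A\<^esub> \<theta> g s = \<theta> g s"
    and u: "u \<in> set_product A (\<otimes>\<^bsub>A\<^esub>) S T"
  shows "e \<otimes>\<^bsub>A\<^esub> \<theta> g u = \<theta> g u"
proof -
  interpret I: ideal "D (inv\<^bsub>G\<^esub> g)" A using g by (intro dom_ideal) simp
  note im = act_closed[OF g, THEN subsetD[OF dom_subset[OF g]]]
  have "set_product A (\<otimes>\<^bsub>A\<^esub>) S T \<subseteq> {u \<in> D (inv\<^bsub>G\<^esub> g). e \<otimes>\<^bsub>A\<^esub> \<theta> g u = \<theta> g u}"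
  proof (rule set_product_least[OF A.is_abelian_group])
    show "additive_subgroup {u \<in> D (inv\<^bsub>G\<^esub> g). e \<otimes>\<^bsub>A\<^esub> \<theta> g u = \<theta> g u} A"
      using g e im I.Icarr
      by (intro A.additive_subgroupI)
        (auto simp: act_zero act_uminus act_add A.r_minus A.r_distr I.a_inv_closed)
    fix s t assume st: "s \<in> S" "t \<in> T"
    then have "e \<otimes>\<^bsub>A\<^esub> \<theta> g (s \<otimes>\<^bsub>A\<^esub> t) = (e \<otimes>\<^bsub>A\<^esub> \<theta> g s) \<otimes>\<^bsub>A\<^esub> \<theta> g t"
      using S T g e im by (simp add: act_mult A.m_assoc subset_iff)
    with st show "s \<otimes>\<^bsub>A\<^esub> t \<in> {u \<in> D (inv\<^bsub>G\<^esub> g). e \<otimes>\<^bsub>A\<^esub> \<theta> g u = \<theta> g u}"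
      using S T g I.Icarr by (auto simp: fixed act_mult subset_iff intro!: I.I_r_closed)
  qed
  with u show ?thesis by blast
qed

lemma act_fixed_right:
  assumes g: "g \<in> carrier G" and f: "f \<in> carrier A"
    and S: "S \<subseteq> D (inv\<^bsub>G\<^esub> g)" and T: "T \<subseteq> D (inv\<^bsub>G\<^esub> g)"
    and fixed: "\<And>t. t \<in> T \<Longrightarrow> \<theta> g t \<otimes>\<^bsub>A\<^esub> f = \<theta> g t"
    and u: "u \<in> set_product A (\<otimes>\<^bsub>A\<^esub>) S T"
  shows "\<theta> g u \<otimes>\<^bsub>A\<^esub> f = \<theta> g u"
proof -
  interpret I: ideal "D (inv\<^bsub>G\<^esub> g)" A using g by (intro dom_ideal) simp
  note im = act_closed[OF g, THEN subsetD[OF dom_subset[OF g]]]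
  have "set_product A (\<otimes>\<^bsub>A\<^esub>) S T \<subseteq> {u \<in> D (inv\<^bsub>G\<^esub> g). \<theta> g u \<otimes>\<^bsub>A\<^esub> f = \<theta> g u}"
  proof (rule set_product_least[OF A.is_abelian_group])
    show "additive_subgroup {u \<in> D (inv\<^bsub>G\<^esub> g). \<theta> g u \<otimes>\<^bsub>A\<^esub> f = \<theta> g u} A"
      using g f im I.Icarr
      by (intro A.additive_subgroupI)
        (auto simp: act_zero act_uminus act_add A.l_minus A.l_distr I.a_inv_closed)
    fix s t assume st: "s \<in> S" "t \<in> T"
    then have "\<theta> g (s \<otimes>\<^bsub>A\<^esub> t) \<otimes>\<^bsub>A\<^esub> f = \<theta> g s \<otimes>\<^bsub>A\<^esub> (\<theta> g t \<otimes>\<^bsub>A\<^esub> f)"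
      using S T g f im by (simp add: act_mult A.m_assoc subset_iff)
    with st show "s \<otimes>\<^bsub>A\<^esub> t \<in> {u \<in> D (inv\<^bsub>G\<^esub> g). \<theta> g u \<otimes>\<^bsub>A\<^esub> f = \<theta> g u}"
      using S T g I.Icarr by (auto simp: fixed act_mult subset_iff intro!: I.I_r_closed)
  qed
  with u show ?thesis by blast
qed

text \<open>
  What is needed of the statement that \<open>\<theta>\<close> restricts to a regular partial action on the corner
  \<open>e A e\<close>: the corner is mapped to itself, and the intersection of two of its domains is contained in
  their product.
\<close>

definition regular_corner :: "'a \<Rightarrow> bool" where
  "regular_corner e \<longleftrightarrow> e \<in> carrier A \<and> (\<forall>g\<in>carrier G.
    (\<forall>d\<in>D (inv\<^bsub>G\<^esub> g) \<inter> peirce A e e. \<theta> g d \<in> peirce A e e) \<and>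
    (\<forall>h\<in>carrier G. D g \<inter> D h \<inter> peirce A e e \<subseteq>
      set_product A (\<otimes>\<^bsub>A\<^esub>) (D g \<inter> peirce A e e) (D h \<inter> peirce A e e)))"

lemma regular_corner_idem:
  "\<lbrakk>regular_corner e; g \<in> carrier G\<rbrakk> \<Longrightarrow> D g \<inter> peirce A e e \<subseteq>
    set_product A (\<otimes>\<^bsub>A\<^esub>) (D g \<inter> peirce A e e) (D g \<inter> peirce A e e)"
  unfolding regular_corner_def by fastforce

text \<open>
  Let \<open>D = D (inv g)\<close>.  The left identity \<open>e\<close> survives because
  \<open>D \<inter> e A f = (D \<inter> e A e) (e A f) = (D \<inter> e A e) (D \<inter> e A e) (e A f)\<close>.  The last two
  factors together lie in \<open>D\<close>, so \<open>\<theta> g\<close> may be applied to the first factor and to their product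
  separately, and the image of the first factor lies in \<open>e A e\<close>.  The argument for \<open>f\<close> is the mirror image.
\<close>

lemma act_peirce:
  assumes g: "g \<in> carrier G" and e: "regular_corner e" and f: "regular_corner f"
    and full_e: "e \<in> set_product A (\<otimes>\<^bsub>A\<^esub>) (peirce A e f) (peirce A f e)"
    and full_f: "f \<in> set_product A (\<otimes>\<^bsub>A\<^esub>) (peirce A f e) (peirce A e f)"
    and u: "u \<in> D (inv\<^bsub>G\<^esub> g) \<inter> peirce A e f"
  shows "\<theta> g u \<in> D g \<inter> peirce A e f"
proof -
  interpret I: ideal "D (inv\<^bsub>G\<^esub> g)" A using g by (intro dom_ideal) simp
  have ig: "inv\<^bsub>G\<^esub> g \<in> carrier G" using g by simp
  have eA: "e \<in> carrier A" and fA: "f \<in> carrier A"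
    using e f by (auto simp: regular_corner_def)
  let ?D = "D (inv\<^bsub>G\<^esub> g)" let ?E = "?D \<inter> peirce A e e" let ?F = "?D \<inter> peirce A f f"
  let ?M = "peirce A e f"
  note sub = A.peirce_subset I.a_subset
  have sE: "?E \<subseteq> carrier A" and sF: "?F \<subseteq> carrier A" using sub by auto
  have left: "?D \<inter> ?M = set_product A (\<otimes>\<^bsub>A\<^esub>) ?E ?M"
    by (rule A.ideal_peirce_left[OF I.ideal_axioms eA fA full_f])
  have right: "?D \<inter> ?M = set_product A (\<otimes>\<^bsub>A\<^esub>) ?M ?F"
    by (rule A.ideal_peirce_right[OF I.ideal_axioms eA fA full_e])
  have "?D \<inter> ?M \<subseteq> set_product A (\<otimes>\<^bsub>A\<^esub>) (set_product A (\<otimes>\<^bsub>A\<^esub>) ?E ?E) ?M"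
    unfolding left using regular_corner_idem[OF e ig] sE sub
    by (intro A.set_product_ring_mono A.set_product_in_carrier) auto
  also have "\<dots> \<subseteq> set_product A (\<otimes>\<^bsub>A\<^esub>) ?E (?D \<inter> ?M)"
    unfolding left using sE sub by (intro A.set_product_assoc_subset)
  finally have L: "u \<in> set_product A (\<otimes>\<^bsub>A\<^esub>) ?E (?D \<inter> ?M)" using u by blast
  have "?D \<inter> ?M \<subseteq> set_product A (\<otimes>\<^bsub>A\<^esub>) ?M (set_product A (\<otimes>\<^bsub>A\<^esub>) ?F ?F)"
    unfolding right using regular_corner_idem[OF f ig] sF sub
    by (intro A.set_product_ring_mono A.set_product_in_carrier) auto
  also have "\<dots> \<subseteq> set_product A (\<otimes>\<^bsub>A\<^esub>) (?D \<inter> ?M) ?F"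
    unfolding right using sF sub by (intro A.set_product_assoc_superset)
  finally have R: "u \<in> set_product A (\<otimes>\<^bsub>A\<^esub>) (?D \<inter> ?M) ?F" using u by blast
  have "e \<otimes>\<^bsub>A\<^esub> \<theta> g u = \<theta> g u"
    by (rule act_fixed_left[OF g eA _ _ _ L])
      (use e g in \<open>auto simp: regular_corner_def peirce_def\<close>)
  moreover have "\<theta> g u \<otimes>\<^bsub>A\<^esub> f = \<theta> g u"
    by (rule act_fixed_right[OF g fA _ _ _ R])
      (use f g in \<open>auto simp: regular_corner_def peirce_def\<close>)
  ultimately show ?thesis
    using act_closed[OF g, of u] u dom_subset[OF g] by (auto simp: peirce_def)
qed

text \<open>
  The inverse of \<open>\<theta> g\<close> on \<open>e A f\<close> is \<open>\<theta> (inv g)\<close>, which preserves \<open>e A f\<close> for the same reason.  The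
  hypothesis on intersections is what \<open>act_comp_product\<close> requires.
\<close>

lemma datum_component_peirce:
  assumes e: "regular_corner e" and f: "regular_corner f"
    and full_e: "e \<in> set_product A (\<otimes>\<^bsub>A\<^esub>) (peirce A e f) (peirce A f e)"
    and full_f: "f \<in> set_product A (\<otimes>\<^bsub>A\<^esub>) (peirce A f e) (peirce A e f)"
    and inter: "\<And>g h. \<lbrakk>g \<in> carrier G; h \<in> carrier G\<rbrakk> \<Longrightarrow>
      D g \<inter> D h \<inter> peirce A e f \<subseteq> set_product A (\<otimes>\<^bsub>A\<^esub>) (D g) (D h)"
  shows "datum_component G A (\<lambda>g. D g \<inter> peirce A e f) \<theta>"
  unfolding datum_component_def
proof (intro conjI ballI impI)
  note stable = act_peirce[OF _ e f full_e full_f]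
  fix g assume g: "g \<in> carrier G"
  show "bij_betw (\<theta> g) (D (inv\<^bsub>G\<^esub> g) \<inter> peirce A e f) (D g \<inter> peirce A e f)"
  proof (rule bij_betw_byWitness[where f' = "\<theta> (inv\<^bsub>G\<^esub> g)"])
    show "\<forall>a\<in>D (inv\<^bsub>G\<^esub> g) \<inter> peirce A e f. \<theta> (inv\<^bsub>G\<^esub> g) (\<theta> g a) = a"
      using act_inv_act[OF g] by auto
    show "\<forall>b\<in>D g \<inter> peirce A e f. \<theta> g (\<theta> (inv\<^bsub>G\<^esub> g) b) = b"
      using act_inv_act[of "inv\<^bsub>G\<^esub> g"] g by auto
    show "\<theta> g ` (D (inv\<^bsub>G\<^esub> g) \<inter> peirce A e f) \<subseteq> D g \<inter> peirce A e f"
      using stable[OF g] by auto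
    show "\<theta> (inv\<^bsub>G\<^esub> g) ` (D g \<inter> peirce A e f) \<subseteq> D (inv\<^bsub>G\<^esub> g) \<inter> peirce A e f"
      using stable[of "inv\<^bsub>G\<^esub> g"] g by auto
  qed
  show "\<theta> g (u \<oplus>\<^bsub>A\<^esub> v) = \<theta> g u \<oplus>\<^bsub>A\<^esub> \<theta> g v"
    if "u \<in> D (inv\<^bsub>G\<^esub> g) \<inter> peirce A e f" "v \<in> D (inv\<^bsub>G\<^esub> g) \<inter> peirce A e f" for u v
    using that g by (auto intro: act_add)
  fix h a
  assume h: "h \<in> carrier G" and a: "a \<in> D (inv\<^bsub>G\<^esub> h) \<inter> peirce A e f"
    and ha: "\<theta> h a \<in> (D (inv\<^bsub>G\<^esub> g) \<inter> peirce A e f) \<inter> (D h \<inter> peirce A e f)"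
  have "\<theta> h a \<in> set_product A (\<otimes>\<^bsub>A\<^esub>) (D h) (D (inv\<^bsub>G\<^esub> g))"
    using inter[of h "inv\<^bsub>G\<^esub> g"] g h ha by auto
  note comp = act_comp_product[OF g h _ this]
  show "a \<in> D (inv\<^bsub>G\<^esub> (g \<otimes>\<^bsub>G\<^esub> h)) \<inter> peirce A e f" "\<theta> g (\<theta> h a) = \<theta> (g \<otimes>\<^bsub>G\<^esub> h) a"
    using comp a by auto
qed (simp add: act_one)

end


section \<open>Charts of Peirce components\<close>

definition pullback :: "('m, 'z) ring_scheme \<Rightarrow> ('m \<Rightarrow> 'r) \<Rightarrow> ('g \<Rightarrow> 'r \<Rightarrow> 'r) \<Rightarrow> 'g \<Rightarrow> 'm \<Rightarrow> 'm" where
  "pullback M \<iota> \<theta> g u = inv_into (carrier M) \<iota> (\<theta> g (\<iota> u))"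

context product_partial_action
begin

text \<open>
  The condition under which \<open>pullback M \<iota> \<theta> g\<close> is the restriction of \<open>\<theta> g\<close> to \<open>M\<close>, regarded as a subset
  of \<open>A\<close> by means of \<open>\<iota>\<close>, with \<open>P g\<close> in the role of \<open>D g \<inter> M\<close>.
\<close>

definition pulls_back :: "('m, 'z) ring_scheme \<Rightarrow> ('m \<Rightarrow> 'a) \<Rightarrow> ('g \<Rightarrow> 'm set) \<Rightarrow> bool" where
  "pulls_back M \<iota> P \<longleftrightarrow> inj_on \<iota> (carrier M) \<and> (\<forall>g\<in>carrier G.
    P g = {u \<in> carrier M. \<iota> u \<in> D g} \<and>
    (\<forall>u\<in>P (inv\<^bsub>G\<^esub> g). \<theta> g (\<iota> u) \<in> \<iota> ` carrier M))"

lemma pullback_act: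
  assumes "pulls_back M \<iota> P" "g \<in> carrier G" "u \<in> P (inv\<^bsub>G\<^esub> g)"
  shows "pullback M \<iota> \<theta> g u \<in> carrier M" "\<iota> (pullback M \<iota> \<theta> g u) = \<theta> g (\<iota> u)"
proof -
  have "\<theta> g (\<iota> u) \<in> \<iota> ` carrier M" using assms by (simp add: pulls_back_def)
  then show "pullback M \<iota> \<theta> g u \<in> carrier M" "\<iota> (pullback M \<iota> \<theta> g u) = \<theta> g (\<iota> u)"
    by (auto simp: pullback_def inv_into_into f_inv_into_f)
qed

lemma pulls_back_dom:
  "\<lbrakk>pulls_back M \<iota> P; g \<in> carrier G\<rbrakk> \<Longrightarrow> u \<in> P g \<longleftrightarrow> u \<in> carrier M \<and> \<iota> u \<in> D g"
  by (auto simp: pulls_back_def)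

lemma pulls_back_inj:
  "\<lbrakk>pulls_back M \<iota> P; u \<in> carrier M; v \<in> carrier M; \<iota> u = \<iota> v\<rbrakk> \<Longrightarrow> u = v"
  by (auto simp: pulls_back_def dest: inj_onD)

lemma datum_mult_pullback:
  assumes 1: "pulls_back M\<^sub>1 \<iota>\<^sub>1 P\<^sub>1" and 2: "pulls_back M\<^sub>2 \<iota>\<^sub>2 P\<^sub>2" and 3: "pulls_back M\<^sub>3 \<iota>\<^sub>3 P\<^sub>3"
    and closed: "\<And>u v. \<lbrakk>u \<in> carrier M\<^sub>1; v \<in> carrier M\<^sub>2\<rbrakk> \<Longrightarrow> f u v \<in> carrier M\<^sub>3"
    and mult: "\<And>u v. \<lbrakk>u \<in> carrier M\<^sub>1; v \<in> carrier M\<^sub>2\<rbrakk> \<Longrightarrow> \<iota>\<^sub>3 (f u v) = \<iota>\<^sub>1 u \<otimes>\<^bsub>A\<^esub> \<iota>\<^sub>2 v"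
  shows "datum_mult G f P\<^sub>1 P\<^sub>2 (pullback M\<^sub>1 \<iota>\<^sub>1 \<theta>) (pullback M\<^sub>2 \<iota>\<^sub>2 \<theta>) (pullback M\<^sub>3 \<iota>\<^sub>3 \<theta>)"
  unfolding datum_mult_def
proof (intro ballI)
  fix g u v assume g: "g \<in> carrier G" and u: "u \<in> P\<^sub>1 (inv\<^bsub>G\<^esub> g)" and v: "v \<in> P\<^sub>2 (inv\<^bsub>G\<^esub> g)"
  have ig: "inv\<^bsub>G\<^esub> g \<in> carrier G" using g by simp
  interpret I: ideal "D (inv\<^bsub>G\<^esub> g)" A using ig by (rule dom_ideal)
  note u' = pulls_back_dom[OF 1 ig, THEN iffD1, OF u]
    and v' = pulls_back_dom[OF 2 ig, THEN iffD1, OF v]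
  have uv: "f u v \<in> P\<^sub>3 (inv\<^bsub>G\<^esub> g)"
    using u' v' closed mult I.Icarr by (simp add: pulls_back_dom[OF 3 ig] I.I_r_closed)
  note gu = pullback_act[OF 1 g u] and gv = pullback_act[OF 2 g v] and guv = pullback_act[OF 3 g uv]
  show "f (pullback M\<^sub>1 \<iota>\<^sub>1 \<theta> g u) (pullback M\<^sub>2 \<iota>\<^sub>2 \<theta> g v) = pullback M\<^sub>3 \<iota>\<^sub>3 \<theta> g (f u v)"
    using gu gv guv u' v' g
    by (intro pulls_back_inj[OF 3]) (simp_all add: closed mult act_mult)
qed

text \<open>
  The values of \<open>\<theta>\<close> on \<open>\<iota> ` M\<close> determine the pulled back maps, so each clause for \<open>M\<close> is the
  corresponding clause for the image in \<open>A\<close>, read through the injection \<open>\<iota>\<close>.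
\<close>

lemma datum_component_pullback:
  assumes M: "abelian_group M" and P: "pulls_back M \<iota> P"
    and \<iota>_closed: "\<And>u. u \<in> carrier M \<Longrightarrow> \<iota> u \<in> carrier A"
    and \<iota>_add: "\<And>u v. \<lbrakk>u \<in> carrier M; v \<in> carrier M\<rbrakk> \<Longrightarrow> \<iota> (u \<oplus>\<^bsub>M\<^esub> v) = \<iota> u \<oplus>\<^bsub>A\<^esub> \<iota> v"
    and R: "datum_component G A (\<lambda>g. \<iota> ` P g) \<theta>"
  shows "datum_component G M P (pullback M \<iota> \<theta>)"
proof -
  interpret M: abelian_group M by fact
  note act = pullback_act[OF P] and inj = pulls_back_inj[OF P] and dom = pulls_back_dom[OF P]
  have injP: "u = v" if "g \<in> carrier G" "u \<in> P g" "v \<in> P g" "\<iota> u = \<iota> v" for g u v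
    using that dom inj by blast
  have image: "u \<in> P g" if "g \<in> carrier G" "u \<in> carrier M" "\<iota> u \<in> \<iota> ` P g" for g u
    using that dom by auto
  show ?thesis
    unfolding datum_component_def
  proof (intro conjI ballI impI)
    fix g assume g: "g \<in> carrier G"
    then have ig: "inv\<^bsub>G\<^esub> g \<in> carrier G" by simp
    have bij: "bij_betw (\<theta> g) (\<iota> ` P (inv\<^bsub>G\<^esub> g)) (\<iota> ` P g)"
      using R g by (simp add: datum_component_def)
    have inv: "bij_betw (inv_into (carrier M) \<iota>) (\<iota> ` P g) (P g)"
    proof (rule bij_betw_byWitness[where f' = \<iota>])
      show "\<forall>b\<in>\<iota> ` P g. \<iota> (inv_into (carrier M) \<iota> b) = b"
        using dom[OF g] by (auto intro!: f_inv_into_f)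
      show "\<forall>u\<in>P g. inv_into (carrier M) \<iota> (\<iota> u) = u"
        using dom[OF g] P by (auto simp: pulls_back_def)
      then show "inv_into (carrier M) \<iota> ` \<iota> ` P g \<subseteq> P g" by auto
    qed simp
    have \<iota>: "bij_betw \<iota> (P (inv\<^bsub>G\<^esub> g)) (\<iota> ` P (inv\<^bsub>G\<^esub> g))"
      using injP[OF ig] by (auto simp: bij_betw_def inj_on_def)
    have "pullback M \<iota> \<theta> g = inv_into (carrier M) \<iota> \<circ> (\<theta> g \<circ> \<iota>)"
      by (auto simp: pullback_def)
    then show "bij_betw (pullback M \<iota> \<theta> g) (P (inv\<^bsub>G\<^esub> g)) (P g)"
      using bij_betw_trans[OF bij_betw_trans[OF \<iota> bij] inv] by simp
    show "pullback M \<iota> \<theta> g (u \<oplus>\<^bsub>M\<^esub> v) = pullback M \<iota> \<theta> g u \<oplus>\<^bsub>M\<^esub> pullback M \<iota> \<theta> g v"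
      if u: "u \<in> P (inv\<^bsub>G\<^esub> g)" and v: "v \<in> P (inv\<^bsub>G\<^esub> g)" for u v
    proof -
      interpret I: ideal "D (inv\<^bsub>G\<^esub> g)" A using ig by (rule dom_ideal)
      have uv: "u \<oplus>\<^bsub>M\<^esub> v \<in> P (inv\<^bsub>G\<^esub> g)"
        using u v by (simp add: dom[OF ig] \<iota>_add I.a_closed)
      show ?thesis
        using act[OF g u] act[OF g v] act[OF g uv] u v g
        by (intro inj) (simp_all add: \<iota>_add act_add dom[OF ig])
    qed
    fix h a
    assume h: "h \<in> carrier G" and a: "a \<in> P (inv\<^bsub>G\<^esub> h)"
      and ha: "pullback M \<iota> \<theta> h a \<in> P (inv\<^bsub>G\<^esub> g) \<inter> P h"
    have "\<theta> h (\<iota> a) \<in> \<iota> ` P (inv\<^bsub>G\<^esub> g) \<inter> \<iota> ` P h"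
      using ha act(2)[OF h a] by (metis Int_iff imageI)
    then have comp: "\<iota> a \<in> \<iota> ` P (inv\<^bsub>G\<^esub> (g \<otimes>\<^bsub>G\<^esub> h))" "\<theta> g (\<theta> h (\<iota> a)) = \<theta> (g \<otimes>\<^bsub>G\<^esub> h) (\<iota> a)"
      using R g h a by (auto simp: datum_component_def)
    then show a': "a \<in> P (inv\<^bsub>G\<^esub> (g \<otimes>\<^bsub>G\<^esub> h))"
      using g h a dom[of "inv\<^bsub>G\<^esub> h"] by (intro image) auto
    have gha: "pullback M \<iota> \<theta> h a \<in> P (inv\<^bsub>G\<^esub> g)" using ha by simp
    have gh: "g \<otimes>\<^bsub>G\<^esub> h \<in> carrier G" using g h by simp
    show "pullback M \<iota> \<theta> g (pullback M \<iota> \<theta> h a) = pullback M \<iota> \<theta> (g \<otimes>\<^bsub>G\<^esub> h) a"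
      using act[OF g gha] act[OF gh a'] act[OF h a] comp(2) by (intro inj) simp_all
  next
    fix u assume u: "u \<in> carrier M"
    then have "u \<in> P (inv\<^bsub>G\<^esub> \<one>\<^bsub>G\<^esub>)" using dom[of "\<one>\<^bsub>G\<^esub>"] \<iota>_closed by (simp add: dom_one)
    with u show "pullback M \<iota> \<theta> \<one>\<^bsub>G\<^esub> u = u"
      using act[of "\<one>\<^bsub>G\<^esub>" u] \<iota>_closed by (intro inj) (simp_all add: act_one)
  qed
qed

text \<open>
  The case of two group elements of \<open>regular_domains\<close>, moved to the corner by \<open>\<kappa>\<close>.  With two equal
  elements it gives the idempotence of the domains, on which \<open>act_peirce\<close> rests.
\<close>

lemma regular_cornerI:
  assumes e: "e \<in> carrier A" and L: "ring L"
    and image: "\<kappa> ` carrier L = peirce A e e" and inj: "inj_on \<kappa> (carrier L)"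
    and add: "\<And>x y. \<lbrakk>x \<in> carrier L; y \<in> carrier L\<rbrakk> \<Longrightarrow> \<kappa> (x \<oplus>\<^bsub>L\<^esub> y) = \<kappa> x \<oplus>\<^bsub>A\<^esub> \<kappa> y"
    and mult: "\<And>x y. \<lbrakk>x \<in> carrier L; y \<in> carrier L\<rbrakk> \<Longrightarrow> \<kappa> (x \<otimes>\<^bsub>L\<^esub> y) = \<kappa> x \<otimes>\<^bsub>A\<^esub> \<kappa> y"
    and L_act: "partial_action G L E \<alpha>" and regular: "regular_domains G L E"
    and restr: "restricts_to G L \<kappa> D \<theta> E \<alpha>"
  shows "regular_corner e"
proof -
  interpret L: partial_action G L E \<alpha> by fact
  have E: "\<kappa> ` E g = D g \<inter> peirce A e e" if "g \<in> carrier G" for g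
    using restr that image by (simp add: restricts_to_def)
  have E_sub: "E g \<subseteq> carrier L" if "g \<in> carrier G" for g
    using ideal.Icarr[OF L.dom_ideal[OF that]] by blast
  have "\<theta> g d \<in> peirce A e e" if g: "g \<in> carrier G" and d: "d \<in> D (inv\<^bsub>G\<^esub> g) \<inter> peirce A e e" for g d
  proof -
    obtain a where a: "a \<in> E (inv\<^bsub>G\<^esub> g)" "d = \<kappa> a" using d E[of "inv\<^bsub>G\<^esub> g"] g by auto
    then have "\<alpha> g a \<in> carrier L"
      using L.act_iso[OF g] E_sub[OF g] by (auto simp: ideal_iso_def bij_betw_def)
    moreover have "\<theta> g d = \<kappa> (\<alpha> g a)" using restr a g by (simp add: restricts_to_def)
    ultimately show ?thesis using image by blast
  qed
  moreover have "D g \<inter> D h \<inter> peirce A e e \<subseteq>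
      set_product A (\<otimes>\<^bsub>A\<^esub>) (D g \<inter> peirce A e e) (D h \<inter> peirce A e e)"
    if g: "g \<in> carrier G" and h: "h \<in> carrier G" for g h
  proof -
    have sub: "E g \<subseteq> carrier L" "E h \<subseteq> carrier L" using E_sub g h by auto
    have "{foldr (\<otimes>\<^bsub>L\<^esub>) xs \<one>\<^bsub>L\<^esub> | xs. list_all2 (\<lambda>x g. x \<in> E g) xs [g, h]} =
        {x \<otimes>\<^bsub>L\<^esub> y | x y. x \<in> E g \<and> y \<in> E h}" (is "?S = ?T")
    proof (intro subset_antisym subsetI)
      fix z assume "z \<in> ?S"
      then obtain x y where xy: "x \<in> E g" "y \<in> E h" "z = x \<otimes>\<^bsub>L\<^esub> (y \<otimes>\<^bsub>L\<^esub> \<one>\<^bsub>L\<^esub>)"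
        by (auto simp: list_all2_Cons2)
      moreover have "y \<otimes>\<^bsub>L\<^esub> \<one>\<^bsub>L\<^esub> = y" using xy sub by auto
      ultimately show "z \<in> ?T" by auto
    next
      fix z assume "z \<in> ?T"
      then obtain x y where xy: "x \<in> E g" "y \<in> E h" "z = x \<otimes>\<^bsub>L\<^esub> y" by blast
      with sub show "z \<in> ?S" by (auto intro!: exI[of _ "[x, y]"])
    qed
    moreover have "(\<Inter>k\<in>set [g, h]. E k) = generate (add_monoid L) ?S"
      using regular g h by (intro regular[unfolded regular_domains_def, rule_format]) auto
    ultimately have "E g \<inter> E h = set_product L (\<otimes>\<^bsub>L\<^esub>) (E g) (E h)"
      by (simp add: set_product_def)
    moreover have "\<kappa> ` (E g \<inter> E h) = D g \<inter> D h \<inter> peirce A e e"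
      using inj_on_image_Int[OF inj sub] E[OF g] E[OF h] by auto
    moreover have "\<kappa> ` set_product L (\<otimes>\<^bsub>L\<^esub>) (E g) (E h) =
        set_product A (\<otimes>\<^bsub>A\<^esub>) (\<kappa> ` E g) (\<kappa> ` E h)"
    proof (rule image_set_product)
      show "\<kappa> x \<in> carrier A" if "x \<in> carrier L" for x
        using that image A.peirce_subset by blast
    qed (use sub add mult L ring.is_abelian_group A.is_abelian_group in \<open>auto simp: subset_iff\<close>)
    ultimately show ?thesis by (simp add: E g h)
  qed
  ultimately show ?thesis using e by (auto simp: regular_corner_def)
qed

end

text \<open>
  An additive group \<open>M\<close> identified by \<open>\<iota>\<close> with \<open>e R f\<close>, with actions \<open>l\<close> and \<open>r\<close> that \<open>\<kappa>\<close> and \<open>\<mu>\<close> turn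
  into multiplication in \<open>R\<close>, such that \<open>E g\<close> and \<open>F g\<close> correspond to the parts of \<open>C g\<close> in \<open>e R e\<close> and
  \<open>f R f\<close>.
\<close>

locale peirce_chart = product_partial_action G R C \<theta> + M: abelian_group M
  for G (structure) and R (structure) and C :: "'g \<Rightarrow> 'r set" and \<theta> and M (structure) +
  fixes e f :: 'r and L :: "'l set" and N :: "'n set"
    and \<kappa> :: "'l \<Rightarrow> 'r" and \<mu> :: "'n \<Rightarrow> 'r" and \<iota> :: "'m \<Rightarrow> 'r"
    and l :: "'l \<Rightarrow> 'm \<Rightarrow> 'm" and r :: "'m \<Rightarrow> 'n \<Rightarrow> 'm"
    and E :: "'g \<Rightarrow> 'l set" and F :: "'g \<Rightarrow> 'n set"
  assumes corners: "regular_corner e" "regular_corner f"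
    and full_e: "e \<in> set_product R (\<otimes>\<^bsub>R\<^esub>) (peirce R e f) (peirce R f e)"
    and full_f: "f \<in> set_product R (\<otimes>\<^bsub>R\<^esub>) (peirce R f e) (peirce R e f)"
    and E_subset: "g \<in> carrier G \<Longrightarrow> E g \<subseteq> L" and F_subset: "g \<in> carrier G \<Longrightarrow> F g \<subseteq> N"
    and E_image: "g \<in> carrier G \<Longrightarrow> \<kappa> ` E g = C g \<inter> peirce R e e"
    and F_image: "g \<in> carrier G \<Longrightarrow> \<mu> ` F g = C g \<inter> peirce R f f"
    and inj: "inj_on \<iota> (carrier M)" and image: "\<iota> ` carrier M = peirce R e f"
    and add: "\<lbrakk>x \<in> carrier M; y \<in> carrier M\<rbrakk> \<Longrightarrow> \<iota> (x \<oplus>\<^bsub>M\<^esub> y) = \<iota> x \<oplus>\<^bsub>R\<^esub> \<iota> y"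
    and l_closed: "\<lbrakk>a \<in> L; x \<in> carrier M\<rbrakk> \<Longrightarrow> l a x \<in> carrier M"
    and r_closed: "\<lbrakk>x \<in> carrier M; b \<in> N\<rbrakk> \<Longrightarrow> r x b \<in> carrier M"
    and l_mult: "\<lbrakk>a \<in> L; x \<in> carrier M\<rbrakk> \<Longrightarrow> \<iota> (l a x) = \<kappa> a \<otimes>\<^bsub>R\<^esub> \<iota> x"
    and r_mult: "\<lbrakk>x \<in> carrier M; b \<in> N\<rbrakk> \<Longrightarrow> \<iota> (r x b) = \<iota> x \<otimes>\<^bsub>R\<^esub> \<mu> b"
    and inter: "\<lbrakk>g \<in> carrier G; h \<in> carrier G\<rbrakk> \<Longrightarrow>
      left_dom M l E g \<inter> left_dom M l E h = set_product M l (E g \<inter> E h) (carrier M)"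
begin

lemma e_closed: "e \<in> carrier R" and f_closed: "f \<in> carrier R"
  using corners by (auto simp: regular_corner_def)

lemma chart_closed: "x \<in> carrier M \<Longrightarrow> \<iota> x \<in> carrier R"
  using image A.peirce_subset by blast

lemma image_left_product:
  assumes "S \<subseteq> L"
  shows "\<iota> ` set_product M l S (carrier M) = set_product R (\<otimes>\<^bsub>R\<^esub>) (\<kappa> ` S) (peirce R e f)"
  unfolding image[symmetric]
  by (rule image_set_product[OF M.abelian_group_axioms A.is_abelian_group])
    (use assms add chart_closed l_closed l_mult in auto)

lemma image_left_dom: "g \<in> carrier G \<Longrightarrow> \<iota> ` left_dom M l E g = C g \<inter> peirce R e f"
  using A.ideal_peirce_left[OF dom_ideal e_closed f_closed full_f]
  by (simp add: left_dom_def image_left_product E_subset E_image)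

lemma image_right_dom:
  assumes g: "g \<in> carrier G"
  shows "\<iota> ` right_dom M r F g = C g \<inter> peirce R e f"
proof -
  have "\<iota> ` right_dom M r F g = set_product R (\<otimes>\<^bsub>R\<^esub>) (\<iota> ` carrier M) (\<mu> ` F g)"
    unfolding right_dom_def
    by (rule image_set_product[OF M.abelian_group_axioms A.is_abelian_group])
      (use F_subset[OF g] add chart_closed r_closed r_mult in auto)
  then show ?thesis
    using A.ideal_peirce_right[OF dom_ideal[OF g] e_closed f_closed full_e]
    by (simp add: image F_image[OF g])
qed

lemma left_dom_subset:
  assumes g: "g \<in> carrier G"
  shows "left_dom M l E g \<subseteq> carrier M"
  unfolding left_dom_def
  by (rule additive_subgroup.a_subset, rule set_product_subgroup[OF M.abelian_group_axioms])
    (use E_subset[OF g] l_closed in auto)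

lemma right_dom_subset:
  assumes g: "g \<in> carrier G"
  shows "right_dom M r F g \<subseteq> carrier M"
  unfolding right_dom_def
  by (rule additive_subgroup.a_subset, rule set_product_subgroup[OF M.abelian_group_axioms])
    (use F_subset[OF g] r_closed in auto)

lemma left_dom_eq_right_dom: "g \<in> carrier G \<Longrightarrow> left_dom M l E g = right_dom M r F g"
  using inj_on_image_eq_iff[OF inj left_dom_subset right_dom_subset]
    image_left_dom image_right_dom by blast

lemma chart_pulls_back: "pulls_back M \<iota> (left_dom M l E)"
  unfolding pulls_back_def
proof (intro conjI ballI inj)
  fix g assume g: "g \<in> carrier G"
  show "left_dom M l E g = {u \<in> carrier M. \<iota> u \<in> C g}"
  proof (intro subset_antisym subsetI)
    fix u assume "u \<in> left_dom M l E g"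
    then show "u \<in> {u \<in> carrier M. \<iota> u \<in> C g}"
      using image_left_dom[OF g] left_dom_subset[OF g] by blast
  next
    fix u assume u: "u \<in> {u \<in> carrier M. \<iota> u \<in> C g}"
    then have "\<iota> u \<in> \<iota> ` left_dom M l E g" using image image_left_dom[OF g] by auto
    then show "u \<in> left_dom M l E g"
      using u inj_on_image_mem_iff[OF inj _ left_dom_subset[OF g]] by simp
  qed
  fix u assume "u \<in> left_dom M l E (inv\<^bsub>G\<^esub> g)"
  then have "\<iota> u \<in> C (inv\<^bsub>G\<^esub> g) \<inter> peirce R e f"
    using image_left_dom[of "inv\<^bsub>G\<^esub> g"] g by auto
  then show "\<theta> g (\<iota> u) \<in> \<iota> ` carrier M"
    using act_peirce[OF g corners full_e full_f] image by blast
qed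

text \<open>
  The intersection hypothesis splits an element of both domains of \<open>M\<close> over \<open>E g \<inter> E h\<close>, regularity
  splits that again over \<open>E g E h\<close>, and the factor in \<open>E h\<close> is absorbed into \<open>C h\<close> together with the
  module element.
\<close>

lemma chart_intersection:
  assumes g: "g \<in> carrier G" and h: "h \<in> carrier G"
  shows "C g \<inter> C h \<inter> peirce R e f \<subseteq> set_product R (\<otimes>\<^bsub>R\<^esub>) (C g) (C h)"
proof -
  let ?Eg = "C g \<inter> peirce R e e" and ?Eh = "C h \<inter> peirce R e e"
  have sub: "?Eg \<subseteq> carrier R" "?Eh \<subseteq> carrier R" using A.peirce_subset by auto
  have "C g \<inter> C h \<inter> peirce R e f = \<iota> ` (left_dom M l E g \<inter> left_dom M l E h)"
    using inj_on_image_Int[OF inj left_dom_subset[OF g] left_dom_subset[OF h]]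
      image_left_dom[OF g] image_left_dom[OF h] by auto
  also have "\<dots> = set_product R (\<otimes>\<^bsub>R\<^esub>) (\<kappa> ` (E g \<inter> E h)) (peirce R e f)"
    unfolding inter[OF g h] using E_subset[OF g] by (intro image_left_product) auto
  also have "\<dots> \<subseteq> set_product R (\<otimes>\<^bsub>R\<^esub>) (set_product R (\<otimes>\<^bsub>R\<^esub>) ?Eg ?Eh) (peirce R e f)"
  proof (rule A.set_product_ring_mono)
    have "\<kappa> ` (E g \<inter> E h) \<subseteq> C g \<inter> C h \<inter> peirce R e e"
      using E_image[OF g] E_image[OF h] by auto
    also have "\<dots> \<subseteq> set_product R (\<otimes>\<^bsub>R\<^esub>) ?Eg ?Eh"
      using corners(1) g h by (simp add: regular_corner_def)
    finally show "\<kappa> ` (E g \<inter> E h) \<subseteq> set_product R (\<otimes>\<^bsub>R\<^esub>) ?Eg ?Eh" .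
    show "set_product R (\<otimes>\<^bsub>R\<^esub>) ?Eg ?Eh \<subseteq> carrier R"
      using sub by (rule A.set_product_in_carrier)
  qed (use A.peirce_subset in auto)
  also have "\<dots> \<subseteq> set_product R (\<otimes>\<^bsub>R\<^esub>) ?Eg (set_product R (\<otimes>\<^bsub>R\<^esub>) ?Eh (peirce R e f))"
    using sub A.peirce_subset by (intro A.set_product_assoc_subset)
  also have "\<dots> = set_product R (\<otimes>\<^bsub>R\<^esub>) ?Eg (C h \<inter> peirce R e f)"
    using A.ideal_peirce_left[OF dom_ideal[OF h] e_closed f_closed full_f] by simp
  also have "\<dots> \<subseteq> set_product R (\<otimes>\<^bsub>R\<^esub>) (C g) (C h)"
    using dom_subset[OF g] dom_subset[OF h] by (intro A.set_product_ring_mono) auto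
  finally show ?thesis .
qed

lemma chart_datum_component: "datum_component G M (left_dom M l E) (pullback M \<iota> \<theta>)"
proof -
  have "datum_component G R (\<lambda>g. C g \<inter> peirce R e f) \<theta>"
    by (rule datum_component_peirce[OF corners full_e full_f chart_intersection])
  then have "datum_component G R (\<lambda>g. \<iota> ` left_dom M l E g) \<theta>"
    by (simp add: datum_component_def image_left_dom)
  with M.abelian_group_axioms chart_pulls_back chart_closed add show ?thesis
    by (rule datum_component_pullback)
qed

end


section \<open>The Morita ring\<close>

context morita_context
begin

abbreviation (input) "\<R> \<equiv> morita_ring A A' M M' \<tau> \<tau>'"
abbreviation (input) "\<iota>\<^sub>1\<^sub>1 \<equiv> \<lambda>a. (a, \<zero>\<^bsub>M\<^esub>, \<zero>\<^bsub>M'\<^esub>, \<zero>\<^bsub>A'\<^esub>)"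
abbreviation (input) "\<iota>\<^sub>1\<^sub>2 \<equiv> \<lambda>x. (\<zero>\<^bsub>A\<^esub>, x, \<zero>\<^bsub>M'\<^esub>, \<zero>\<^bsub>A'\<^esub>)"
abbreviation (input) "\<iota>\<^sub>2\<^sub>1 \<equiv> \<lambda>y. (\<zero>\<^bsub>A\<^esub>, \<zero>\<^bsub>M\<^esub>, y, \<zero>\<^bsub>A'\<^esub>)"
abbreviation (input) "\<iota>\<^sub>2\<^sub>2 \<equiv> \<lambda>b. (\<zero>\<^bsub>A\<^esub>, \<zero>\<^bsub>M\<^esub>, \<zero>\<^bsub>M'\<^esub>, b)"
abbreviation (input) "e\<^sub>1 \<equiv> (\<one>\<^bsub>A\<^esub>, \<zero>\<^bsub>M\<^esub>, \<zero>\<^bsub>M'\<^esub>, \<zero>\<^bsub>A'\<^esub>)"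
abbreviation (input) "e\<^sub>2 \<equiv> (\<zero>\<^bsub>A\<^esub>, \<zero>\<^bsub>M\<^esub>, \<zero>\<^bsub>M'\<^esub>, \<one>\<^bsub>A'\<^esub>)"

lemma carrier_morita_ring: "carrier \<R> = carrier A \<times> carrier M \<times> carrier M' \<times> carrier A'"
  by (simp add: morita_ring_def)

lemma add_morita_ring: "(a, x, y, b) \<oplus>\<^bsub>\<R>\<^esub> (a', x', y', b') =
    (a \<oplus>\<^bsub>A\<^esub> a', x \<oplus>\<^bsub>M\<^esub> x', y \<oplus>\<^bsub>M'\<^esub> y', b \<oplus>\<^bsub>A'\<^esub> b')"
  by (simp add: morita_ring_def)

lemma mult_morita_ring: "(a, x, y, b) \<otimes>\<^bsub>\<R>\<^esub> (a', x', y', b') =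
    (a \<otimes>\<^bsub>A\<^esub> a' \<oplus>\<^bsub>A\<^esub> \<tau> x y', lsmult M a x' \<oplus>\<^bsub>M\<^esub> rsmult M x b',
     rsmult M' y a' \<oplus>\<^bsub>M'\<^esub> lsmult M' b y', \<tau>' y x' \<oplus>\<^bsub>A'\<^esub> b \<otimes>\<^bsub>A'\<^esub> b')"
  by (simp add: morita_ring_def)

lemma pairing_closed:
  "\<lbrakk>x \<in> carrier M; y \<in> carrier M'\<rbrakk> \<Longrightarrow> \<tau> x y \<in> carrier A"
  "\<lbrakk>x \<in> carrier M; y \<in> carrier M'\<rbrakk> \<Longrightarrow> \<tau>' y x \<in> carrier A'"
  using tau_pairing tau'_pairing by (simp_all add: bimodule_pairing_def)

lemma pairing_zero:
  "y \<in> carrier M' \<Longrightarrow> \<tau> \<zero>\<^bsub>M\<^esub> y = \<zero>\<^bsub>A\<^esub>" "x \<in> carrier M \<Longrightarrow> \<tau> x \<zero>\<^bsub>M'\<^esub> = \<zero>\<^bsub>A\<^esub>"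
  "x \<in> carrier M \<Longrightarrow> \<tau>' \<zero>\<^bsub>M'\<^esub> x = \<zero>\<^bsub>A'\<^esub>" "y \<in> carrier M' \<Longrightarrow> \<tau>' y \<zero>\<^bsub>M\<^esub> = \<zero>\<^bsub>A'\<^esub>"
proof -
  have "\<tau> \<zero>\<^bsub>M\<^esub> y \<oplus>\<^bsub>A\<^esub> \<tau> \<zero>\<^bsub>M\<^esub> y = \<tau> (\<zero>\<^bsub>M\<^esub> \<oplus>\<^bsub>M\<^esub> \<zero>\<^bsub>M\<^esub>) y"
    "\<tau>' y \<zero>\<^bsub>M\<^esub> \<oplus>\<^bsub>A'\<^esub> \<tau>' y \<zero>\<^bsub>M\<^esub> = \<tau>' y (\<zero>\<^bsub>M\<^esub> \<oplus>\<^bsub>M\<^esub> \<zero>\<^bsub>M\<^esub>)" if "y \<in> carrier M'" for y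
    using that tau_pairing tau'_pairing M.M.zero_closed
    by (simp_all only: bimodule_pairing_def)
  then show "y \<in> carrier M' \<Longrightarrow> \<tau> \<zero>\<^bsub>M\<^esub> y = \<zero>\<^bsub>A\<^esub>" "y \<in> carrier M' \<Longrightarrow> \<tau>' y \<zero>\<^bsub>M\<^esub> = \<zero>\<^bsub>A'\<^esub>"
    by (simp_all add: pairing_closed M.A.add.l_cancel_one' M.B.add.l_cancel_one')
  have "\<tau> x \<zero>\<^bsub>M'\<^esub> \<oplus>\<^bsub>A\<^esub> \<tau> x \<zero>\<^bsub>M'\<^esub> = \<tau> x (\<zero>\<^bsub>M'\<^esub> \<oplus>\<^bsub>M'\<^esub> \<zero>\<^bsub>M'\<^esub>)"
    "\<tau>' \<zero>\<^bsub>M'\<^esub> x \<oplus>\<^bsub>A'\<^esub> \<tau>' \<zero>\<^bsub>M'\<^esub> x = \<tau>' (\<zero>\<^bsub>M'\<^esub> \<oplus>\<^bsub>M'\<^esub> \<zero>\<^bsub>M'\<^esub>) x" if "x \<in> carrier M" for x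
    using that tau_pairing tau'_pairing M'.M.zero_closed
    by (simp_all only: bimodule_pairing_def)
  then show "x \<in> carrier M \<Longrightarrow> \<tau> x \<zero>\<^bsub>M'\<^esub> = \<zero>\<^bsub>A\<^esub>" "x \<in> carrier M \<Longrightarrow> \<tau>' \<zero>\<^bsub>M'\<^esub> x = \<zero>\<^bsub>A'\<^esub>"
    by (simp_all add: pairing_closed M.A.add.l_cancel_one' M.B.add.l_cancel_one')
qed

end

lemma (in bimodule) smult_zero:
  "x \<in> carrier M \<Longrightarrow> lsmult M \<zero>\<^bsub>A\<^esub> x = \<zero>\<^bsub>M\<^esub>" "x \<in> carrier M \<Longrightarrow> rsmult M x \<zero>\<^bsub>B\<^esub> = \<zero>\<^bsub>M\<^esub>"
  "a \<in> carrier A \<Longrightarrow> lsmult M a \<zero>\<^bsub>M\<^esub> = \<zero>\<^bsub>M\<^esub>" "b \<in> carrier B \<Longrightarrow> rsmult M \<zero>\<^bsub>M\<^esub> b = \<zero>\<^bsub>M\<^esub>"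
proof -
  note zero = lsmult_closed rsmult_closed M.add.l_cancel_one'
  show "x \<in> carrier M \<Longrightarrow> lsmult M \<zero>\<^bsub>A\<^esub> x = \<zero>\<^bsub>M\<^esub>"
    using lsmult_add_left[of "\<zero>\<^bsub>A\<^esub>" "\<zero>\<^bsub>A\<^esub>" x] by (simp add: zero)
  show "x \<in> carrier M \<Longrightarrow> rsmult M x \<zero>\<^bsub>B\<^esub> = \<zero>\<^bsub>M\<^esub>"
    using rsmult_add_right[of x "\<zero>\<^bsub>B\<^esub>" "\<zero>\<^bsub>B\<^esub>"] by (simp add: zero)
  show "a \<in> carrier A \<Longrightarrow> lsmult M a \<zero>\<^bsub>M\<^esub> = \<zero>\<^bsub>M\<^esub>"
    using lsmult_add_right[of a "\<zero>\<^bsub>M\<^esub>" "\<zero>\<^bsub>M\<^esub>"] by (simp add: zero)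
  show "b \<in> carrier B \<Longrightarrow> rsmult M \<zero>\<^bsub>M\<^esub> b = \<zero>\<^bsub>M\<^esub>"
    using rsmult_add_left[of "\<zero>\<^bsub>M\<^esub>" "\<zero>\<^bsub>M\<^esub>" b] by (simp add: zero)
qed

context morita_context
begin

lemmas morita_ring_simps = carrier_morita_ring add_morita_ring mult_morita_ring
  pairing_closed pairing_zero
  M.smult_zero M'.smult_zero M.lsmult_closed M.rsmult_closed M'.lsmult_closed M'.rsmult_closed
  M.lsmult_one M.rsmult_one M'.lsmult_one M'.rsmult_one

lemma peirce_morita_ring:
  "\<iota>\<^sub>1\<^sub>1 ` carrier A = peirce \<R> e\<^sub>1 e\<^sub>1" "\<iota>\<^sub>1\<^sub>2 ` carrier M = peirce \<R> e\<^sub>1 e\<^sub>2"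
  "\<iota>\<^sub>2\<^sub>1 ` carrier M' = peirce \<R> e\<^sub>2 e\<^sub>1" "\<iota>\<^sub>2\<^sub>2 ` carrier A' = peirce \<R> e\<^sub>2 e\<^sub>2"
  by (auto simp: peirce_def morita_ring_simps)

text \<open>Surjectivity of the pairings, read inside the Morita ring.\<close>

lemma pairing_full:
  assumes R: "ring \<R>" and \<tau>: "set_product A \<tau> (carrier M) (carrier M') = carrier A"
    and \<tau>': "set_product A' \<tau>' (carrier M') (carrier M) = carrier A'"
  shows "e\<^sub>1 \<in> set_product \<R> (\<otimes>\<^bsub>\<R>\<^esub>) (peirce \<R> e\<^sub>1 e\<^sub>2) (peirce \<R> e\<^sub>2 e\<^sub>1)"
    and "e\<^sub>2 \<in> set_product \<R> (\<otimes>\<^bsub>\<R>\<^esub>) (peirce \<R> e\<^sub>2 e\<^sub>1) (peirce \<R> e\<^sub>1 e\<^sub>2)"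
proof -
  interpret R: ring \<R> by fact
  have "\<iota>\<^sub>1\<^sub>1 ` set_product A \<tau> (carrier M) (carrier M') =
      set_product \<R> (\<otimes>\<^bsub>\<R>\<^esub>) (\<iota>\<^sub>1\<^sub>2 ` carrier M) (\<iota>\<^sub>2\<^sub>1 ` carrier M')"
    by (rule image_set_product[OF M.A.is_abelian_group R.is_abelian_group])
      (auto simp: morita_ring_simps)
  then show "e\<^sub>1 \<in> set_product \<R> (\<otimes>\<^bsub>\<R>\<^esub>) (peirce \<R> e\<^sub>1 e\<^sub>2) (peirce \<R> e\<^sub>2 e\<^sub>1)"
    unfolding \<tau> peirce_morita_ring[symmetric] by auto
  have "\<iota>\<^sub>2\<^sub>2 ` set_product A' \<tau>' (carrier M') (carrier M) =
      set_product \<R> (\<otimes>\<^bsub>\<R>\<^esub>) (\<iota>\<^sub>2\<^sub>1 ` carrier M') (\<iota>\<^sub>1\<^sub>2 ` carrier M)"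
    by (rule image_set_product[OF M.B.is_abelian_group R.is_abelian_group])
      (auto simp: morita_ring_simps)
  then show "e\<^sub>2 \<in> set_product \<R> (\<otimes>\<^bsub>\<R>\<^esub>) (peirce \<R> e\<^sub>2 e\<^sub>1) (peirce \<R> e\<^sub>1 e\<^sub>2)"
    unfolding \<tau>' peirce_morita_ring[symmetric] by auto
qed

text \<open>
  For the diagonal entries fullness is trivial.  This version of it lets the diagonal entries be
  treated as instances of the off-diagonal case.
\<close>

lemma idempotent_full:
  "e\<^sub>1 \<in> set_product \<R> (\<otimes>\<^bsub>\<R>\<^esub>) (peirce \<R> e\<^sub>1 e\<^sub>1) (peirce \<R> e\<^sub>1 e\<^sub>1)"
  "e\<^sub>2 \<in> set_product \<R> (\<otimes>\<^bsub>\<R>\<^esub>) (peirce \<R> e\<^sub>2 e\<^sub>2) (peirce \<R> e\<^sub>2 e\<^sub>2)"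
proof -
  have "e\<^sub>1 \<otimes>\<^bsub>\<R>\<^esub> e\<^sub>1 = e\<^sub>1" "e\<^sub>2 \<otimes>\<^bsub>\<R>\<^esub> e\<^sub>2 = e\<^sub>2" "e\<^sub>1 \<in> peirce \<R> e\<^sub>1 e\<^sub>1" "e\<^sub>2 \<in> peirce \<R> e\<^sub>2 e\<^sub>2"
    by (simp_all add: peirce_def morita_ring_simps)
  then show "e\<^sub>1 \<in> set_product \<R> (\<otimes>\<^bsub>\<R>\<^esub>) (peirce \<R> e\<^sub>1 e\<^sub>1) (peirce \<R> e\<^sub>1 e\<^sub>1)"
    "e\<^sub>2 \<in> set_product \<R> (\<otimes>\<^bsub>\<R>\<^esub>) (peirce \<R> e\<^sub>2 e\<^sub>2) (peirce \<R> e\<^sub>2 e\<^sub>2)"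
    using set_product_mem[of e\<^sub>1 _ e\<^sub>1 _ "(\<otimes>\<^bsub>\<R>\<^esub>)"] set_product_mem[of e\<^sub>2 _ e\<^sub>2 _ "(\<otimes>\<^bsub>\<R>\<^esub>)"]
    by metis+
qed

end

theorem proposition4p16:
  fixes K :: "('k, 'c) ring_scheme"
    and G :: "('g, 'w) monoid_scheme"
    and R\<^sub>1 :: "('k, 'a, 'x) module_scheme"
    and R\<^sub>2 :: "('k, 'b, 'y) module_scheme"
    and M\<^sub>1\<^sub>2 :: "('a, 'b, 'm, 'u) bimodule_scheme"
    and M\<^sub>2\<^sub>1 :: "('b, 'a, 'n, 'v) bimodule_scheme"
    and \<tau>\<^sub>1\<^sub>2 :: "'m \<Rightarrow> 'n \<Rightarrow> 'a"
    and \<tau>\<^sub>2\<^sub>1 :: "'n \<Rightarrow> 'm \<Rightarrow> 'b"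
    and D\<^sub>1 :: "'g \<Rightarrow> 'a set" and \<alpha>\<^sub>1 :: "'g \<Rightarrow> 'a \<Rightarrow> 'a"
    and D\<^sub>2 :: "'g \<Rightarrow> 'b set" and \<alpha>\<^sub>2 :: "'g \<Rightarrow> 'b \<Rightarrow> 'b"
  assumes "group G" and "cring K"
    and "unital_algebra K R\<^sub>1" and "unital_algebra K R\<^sub>2"
    and "algebra_partial_action K G R\<^sub>1 D\<^sub>1 \<alpha>\<^sub>1" and "regular_domains G R\<^sub>1 D\<^sub>1"
    and "algebra_partial_action K G R\<^sub>2 D\<^sub>2 \<alpha>\<^sub>2" and "regular_domains G R\<^sub>2 D\<^sub>2"
    and "morita_equivalent_via G R\<^sub>1 R\<^sub>2 M\<^sub>1\<^sub>2 M\<^sub>2\<^sub>1 \<tau>\<^sub>1\<^sub>2 \<tau>\<^sub>2\<^sub>1 D\<^sub>1 \<alpha>\<^sub>1 D\<^sub>2 \<alpha>\<^sub>2"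
    and "\<And>g h. \<lbrakk>g \<in> carrier G; h \<in> carrier G\<rbrakk> \<Longrightarrow>
      left_dom R\<^sub>1 (\<otimes>\<^bsub>R\<^sub>1\<^esub>) D\<^sub>1 g \<inter> left_dom R\<^sub>1 (\<otimes>\<^bsub>R\<^sub>1\<^esub>) D\<^sub>1 h =
      set_product R\<^sub>1 (\<otimes>\<^bsub>R\<^sub>1\<^esub>) (D\<^sub>1 g \<inter> D\<^sub>1 h) (carrier R\<^sub>1)"
    and "\<And>g h. \<lbrakk>g \<in> carrier G; h \<in> carrier G\<rbrakk> \<Longrightarrow>
      left_dom M\<^sub>1\<^sub>2 (lsmult M\<^sub>1\<^sub>2) D\<^sub>1 g \<inter> left_dom M\<^sub>1\<^sub>2 (lsmult M\<^sub>1\<^sub>2) D\<^sub>1 h =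
      set_product M\<^sub>1\<^sub>2 (lsmult M\<^sub>1\<^sub>2) (D\<^sub>1 g \<inter> D\<^sub>1 h) (carrier M\<^sub>1\<^sub>2)"
    and "\<And>g h. \<lbrakk>g \<in> carrier G; h \<in> carrier G\<rbrakk> \<Longrightarrow>
      left_dom M\<^sub>2\<^sub>1 (lsmult M\<^sub>2\<^sub>1) D\<^sub>2 g \<inter> left_dom M\<^sub>2\<^sub>1 (lsmult M\<^sub>2\<^sub>1) D\<^sub>2 h =
      set_product M\<^sub>2\<^sub>1 (lsmult M\<^sub>2\<^sub>1) (D\<^sub>2 g \<inter> D\<^sub>2 h) (carrier M\<^sub>2\<^sub>1)"
    and "\<And>g h. \<lbrakk>g \<in> carrier G; h \<in> carrier G\<rbrakk> \<Longrightarrow>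
      left_dom R\<^sub>2 (\<otimes>\<^bsub>R\<^sub>2\<^esub>) D\<^sub>2 g \<inter> left_dom R\<^sub>2 (\<otimes>\<^bsub>R\<^sub>2\<^esub>) D\<^sub>2 h =
      set_product R\<^sub>2 (\<otimes>\<^bsub>R\<^sub>2\<^esub>) (D\<^sub>2 g \<inter> D\<^sub>2 h) (carrier R\<^sub>2)"
  shows "\<exists>\<gamma>\<^sub>1\<^sub>1 \<gamma>\<^sub>1\<^sub>2 \<gamma>\<^sub>2\<^sub>1 \<gamma>\<^sub>2\<^sub>2.
    datum K G R\<^sub>1 R\<^sub>2 M\<^sub>1\<^sub>2 M\<^sub>2\<^sub>1 \<tau>\<^sub>1\<^sub>2 \<tau>\<^sub>2\<^sub>1 D\<^sub>1 \<alpha>\<^sub>1 D\<^sub>2 \<alpha>\<^sub>2 \<gamma>\<^sub>1\<^sub>1 \<gamma>\<^sub>1\<^sub>2 \<gamma>\<^sub>2\<^sub>1 \<gamma>\<^sub>2\<^sub>2"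
proof -
  interpret morita_context R\<^sub>1 R\<^sub>2 M\<^sub>1\<^sub>2 M\<^sub>2\<^sub>1 \<tau>\<^sub>1\<^sub>2 \<tau>\<^sub>2\<^sub>1
    using assms(9) by (simp add: morita_equivalent_via_def morita_equivalence_i_def)
  interpret \<alpha>\<^sub>1: algebra_partial_action K G R\<^sub>1 D\<^sub>1 \<alpha>\<^sub>1 by fact
  interpret \<alpha>\<^sub>2: algebra_partial_action K G R\<^sub>2 D\<^sub>2 \<alpha>\<^sub>2 by fact
  let ?R = "morita_ring R\<^sub>1 R\<^sub>2 M\<^sub>1\<^sub>2 M\<^sub>2\<^sub>1 \<tau>\<^sub>1\<^sub>2 \<tau>\<^sub>2\<^sub>1"
  obtain C \<theta> where \<theta>: "product_partial_action G ?R C \<theta>"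
    and restr: "restricts_to G R\<^sub>1 \<iota>\<^sub>1\<^sub>1 C \<theta> D\<^sub>1 \<alpha>\<^sub>1" "restricts_to G R\<^sub>2 \<iota>\<^sub>2\<^sub>2 C \<theta> D\<^sub>2 \<alpha>\<^sub>2"
    using assms(9) unfolding morita_equivalent_via_def morita_equivalence_ii_def by blast
  interpret \<theta>: product_partial_action G ?R C \<theta> by fact
  have surj: "set_product R\<^sub>1 \<tau>\<^sub>1\<^sub>2 (carrier M\<^sub>1\<^sub>2) (carrier M\<^sub>2\<^sub>1) = carrier R\<^sub>1"
    "set_product R\<^sub>2 \<tau>\<^sub>2\<^sub>1 (carrier M\<^sub>2\<^sub>1) (carrier M\<^sub>1\<^sub>2) = carrier R\<^sub>2"
    using assms(9) by (simp_all add: morita_equivalent_via_def morita_equivalence_i_def)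
  note full = pairing_full[OF \<theta>.A.ring_axioms surj] idempotent_full
  have corner1: "\<theta>.regular_corner e\<^sub>1"
    using assms(6) restr(1)
    by (rule \<theta>.regular_cornerI[OF _ M.A.ring_axioms peirce_morita_ring(1)
          _ _ _ \<alpha>\<^sub>1.partial_action_axioms, rotated -2])
      (auto simp: morita_ring_simps inj_on_def)
  have corner2: "\<theta>.regular_corner e\<^sub>2"
    using assms(8) restr(2)
    by (rule \<theta>.regular_cornerI[OF _ M.B.ring_axioms peirce_morita_ring(4)
          _ _ _ \<alpha>\<^sub>2.partial_action_axioms, rotated -2])
      (auto simp: morita_ring_simps inj_on_def)
  have sub: "D\<^sub>1 g \<subseteq> carrier R\<^sub>1" "D\<^sub>2 g \<subseteq> carrier R\<^sub>2" if "g \<in> carrier G" for g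
    using that ideal.Icarr[OF \<alpha>\<^sub>1.dom_ideal] ideal.Icarr[OF \<alpha>\<^sub>2.dom_ideal] by blast+
  have image: "\<iota>\<^sub>1\<^sub>1 ` D\<^sub>1 g = C g \<inter> peirce ?R e\<^sub>1 e\<^sub>1" "\<iota>\<^sub>2\<^sub>2 ` D\<^sub>2 g = C g \<inter> peirce ?R e\<^sub>2 e\<^sub>2"
    if "g \<in> carrier G" for g
    using that restr by (simp_all add: restricts_to_def peirce_morita_ring[symmetric])
  interpret c11: peirce_chart G ?R C \<theta> R\<^sub>1 e\<^sub>1 e\<^sub>1 "carrier R\<^sub>1" "carrier R\<^sub>1" \<iota>\<^sub>1\<^sub>1 \<iota>\<^sub>1\<^sub>1 \<iota>\<^sub>1\<^sub>1
      "(\<otimes>\<^bsub>R\<^sub>1\<^esub>)" "(\<otimes>\<^bsub>R\<^sub>1\<^esub>)" D\<^sub>1 D\<^sub>1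
    using corner1 full sub image assms(10) peirce_morita_ring M.A.abelian_group_axioms
    by unfold_locales (auto simp: morita_ring_simps inj_on_def)
  interpret c12: peirce_chart G ?R C \<theta> M\<^sub>1\<^sub>2 e\<^sub>1 e\<^sub>2 "carrier R\<^sub>1" "carrier R\<^sub>2" \<iota>\<^sub>1\<^sub>1 \<iota>\<^sub>2\<^sub>2 \<iota>\<^sub>1\<^sub>2
      "lsmult M\<^sub>1\<^sub>2" "rsmult M\<^sub>1\<^sub>2" D\<^sub>1 D\<^sub>2
    using corner1 corner2 full sub image assms(11) peirce_morita_ring
    by unfold_locales (auto simp: morita_ring_simps inj_on_def)
  interpret c21: peirce_chart G ?R C \<theta> M\<^sub>2\<^sub>1 e\<^sub>2 e\<^sub>1 "carrier R\<^sub>2" "carrier R\<^sub>1" \<iota>\<^sub>2\<^sub>2 \<iota>\<^sub>1\<^sub>1 \<iota>\<^sub>2\<^sub>1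
      "lsmult M\<^sub>2\<^sub>1" "rsmult M\<^sub>2\<^sub>1" D\<^sub>2 D\<^sub>1
    using corner1 corner2 full sub image assms(12) peirce_morita_ring
    by unfold_locales (auto simp: morita_ring_simps inj_on_def)
  interpret c22: peirce_chart G ?R C \<theta> R\<^sub>2 e\<^sub>2 e\<^sub>2 "carrier R\<^sub>2" "carrier R\<^sub>2" \<iota>\<^sub>2\<^sub>2 \<iota>\<^sub>2\<^sub>2 \<iota>\<^sub>2\<^sub>2
      "(\<otimes>\<^bsub>R\<^sub>2\<^esub>)" "(\<otimes>\<^bsub>R\<^sub>2\<^esub>)" D\<^sub>2 D\<^sub>2
    using corner2 full sub image assms(13) peirce_morita_ring
    by unfold_locales (auto simp: morita_ring_simps inj_on_def)
  note charts = c11.chart_pulls_back c12.chart_pulls_back c21.chart_pulls_back c22.chart_pulls_back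
  \<comment> \<open>The diagonal maps may be pullbacks as well: they agree with \<open>\<alpha>\<^sub>1\<close>, \<open>\<alpha>\<^sub>2\<close> on the domains
      that matter, which makes all eight product rules instances of one lemma.\<close>
  have \<gamma>11: "pullback R\<^sub>1 \<iota>\<^sub>1\<^sub>1 \<theta> g u = \<alpha>\<^sub>1 g u"
    if g: "g \<in> carrier G" and u: "u \<in> left_dom R\<^sub>1 (\<otimes>\<^bsub>R\<^sub>1\<^esub>) D\<^sub>1 (inv\<^bsub>G\<^esub> g)" for g u
  proof -
    have "\<iota>\<^sub>1\<^sub>1 u \<in> \<iota>\<^sub>1\<^sub>1 ` D\<^sub>1 (inv\<^bsub>G\<^esub> g)"
      using c11.image_left_dom[of "inv\<^bsub>G\<^esub> g"] image(1)[of "inv\<^bsub>G\<^esub> g"] g u by blast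
    then have "u \<in> D\<^sub>1 (inv\<^bsub>G\<^esub> g)" by auto
    then have "\<theta> g (\<iota>\<^sub>1\<^sub>1 u) = \<iota>\<^sub>1\<^sub>1 (\<alpha>\<^sub>1 g u)" using restr(1) g by (simp add: restricts_to_def)
    then show ?thesis using \<theta>.pullback_act(2)[OF charts(1) g u] by simp
  qed
  have \<gamma>22: "pullback R\<^sub>2 \<iota>\<^sub>2\<^sub>2 \<theta> g u = \<alpha>\<^sub>2 g u"
    if g: "g \<in> carrier G" and u: "u \<in> left_dom R\<^sub>2 (\<otimes>\<^bsub>R\<^sub>2\<^esub>) D\<^sub>2 (inv\<^bsub>G\<^esub> g)" for g u
  proof -
    have "\<iota>\<^sub>2\<^sub>2 u \<in> \<iota>\<^sub>2\<^sub>2 ` D\<^sub>2 (inv\<^bsub>G\<^esub> g)"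
      using c22.image_left_dom[of "inv\<^bsub>G\<^esub> g"] image(2)[of "inv\<^bsub>G\<^esub> g"] g u by blast
    then have "u \<in> D\<^sub>2 (inv\<^bsub>G\<^esub> g)" by auto
    then have "\<theta> g (\<iota>\<^sub>2\<^sub>2 u) = \<iota>\<^sub>2\<^sub>2 (\<alpha>\<^sub>2 g u)" using restr(2) g by (simp add: restricts_to_def)
    then show ?thesis using \<theta>.pullback_act(2)[OF charts(4) g u] by simp
  qed
  note mult = \<theta>.datum_mult_pullback
  have "datum K G R\<^sub>1 R\<^sub>2 M\<^sub>1\<^sub>2 M\<^sub>2\<^sub>1 \<tau>\<^sub>1\<^sub>2 \<tau>\<^sub>2\<^sub>1 D\<^sub>1 \<alpha>\<^sub>1 D\<^sub>2 \<alpha>\<^sub>2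
      (pullback R\<^sub>1 \<iota>\<^sub>1\<^sub>1 \<theta>) (pullback M\<^sub>1\<^sub>2 \<iota>\<^sub>1\<^sub>2 \<theta>) (pullback M\<^sub>2\<^sub>1 \<iota>\<^sub>2\<^sub>1 \<theta>) (pullback R\<^sub>2 \<iota>\<^sub>2\<^sub>2 \<theta>)"
    unfolding datum_def Let_def
    by (intro conjI ballI assms(5,7) \<gamma>11 \<gamma>22
        c11.left_dom_eq_right_dom c12.left_dom_eq_right_dom
        c21.left_dom_eq_right_dom c22.left_dom_eq_right_dom
        c11.chart_datum_component c12.chart_datum_component
        c21.chart_datum_component c22.chart_datum_component
        mult[OF charts(1) charts(1) charts(1)] mult[OF charts(2) charts(3) charts(1)]
        mult[OF charts(1) charts(2) charts(2)] mult[OF charts(2) charts(4) charts(2)]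
        mult[OF charts(3) charts(1) charts(3)] mult[OF charts(4) charts(3) charts(3)]
        mult[OF charts(3) charts(2) charts(4)] mult[OF charts(4) charts(4) charts(4)])
      (simp_all add: morita_ring_simps)
  then show ?thesis by blast
qed

end
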